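(* Let $\Phi$ be a homogeneous Poisson point process on $\mathbb{R}^2$ of finite intensity whose points carry i.i.d. timers uniform on $[0,1]$. If $\int_{\mathbb{R}^2}h(0,x)\,dx<\infty$, then the $\infty$-Mat\'ern model of $\Phi$ is well defined, in the sense that its thinning indicators are well defined: almost surely there is exactly one family $(e_\infty(x))_{x\in\Phi}$ with values in $\{0,1\}$ such that $$e_\infty(x)=\prod_{y\in\Phi,\ t(y)<t(x)}\bigl(1-e_\infty(y)C(x,y)\bigr)\qquad\text{for all }x\in\Phi .$$
   Context: $h:\mathbb{R}^2\times\mathbb{R}^2\to[0,1]$ is measurable, symmetric and translation invariant ($h(x,y)=h(0,y-x)$). $t(x)$ denotes the timer of $x\in\Phi$. To each unordered pair of distinct points $x,y\in\Phi$ is attached a Boolean variable $C(x,y)=C(y,x)$; given all points and timers these variables are independent with $\mathbf{P}(C(x,y)=1)=h(x,y)$. Products over the empty set equal $1$. The $\infty$-Mat\'ern model is $M^\infty(\Phi,C)=\{x\in\Phi:e_\infty(x)=1\}$. *)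

theory Defs
  imports "HOL-Probability.Probability"
begin

definition homogeneous_poisson_process ::
  "'w measure \<Rightarrow> real \<Rightarrow> ('w \<Rightarrow> (real^2) set) \<Rightarrow> bool" where
  "homogeneous_poisson_process M lam \<Phi> \<longleftrightarrow>
     prob_space M \<and> 0 \<le> lam \<and>
     (\<forall>\<omega>\<in>space M. \<forall>B. bounded B \<longrightarrow> finite (\<Phi> \<omega> \<inter> B)) \<and>
     (\<forall>B. B \<in> sets borel \<and> bounded B \<longrightarrow>
        (\<lambda>\<omega>. card (\<Phi> \<omega> \<inter> B)) \<in> measurable M (count_space UNIV) \<and>
        (\<forall>k. measure M {\<omega> \<in> space M. card (\<Phi> \<omega> \<inter> B) = k} =
           (lam * measure lborel B) ^ k / fact k * exp (- (lam * measure lborel B)))) \<and>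
     (\<forall>n B. (\<forall>i<n. B i \<in> sets borel \<and> bounded (B i)) \<and> disjoint_family_on B {..<n} \<longrightarrow>
        prob_space.indep_vars M (\<lambda>_. count_space UNIV) (\<lambda>i \<omega>. card (\<Phi> \<omega> \<inter> B i)) {..<n::nat})"

text \<open>
  The marks (timers and edge variables) are attached to the points through a measurable
  enumeration \<open>X 0, X 1, \<dots>\<close> of the points. \<open>N\<close> is the total number of points, possibly infinite;
  the values \<open>X n\<close> with \<open>n \<ge> N\<close> carry no meaning.
\<close>

definition point_enumeration ::
  "'w measure \<Rightarrow> ('w \<Rightarrow> (real^2) set) \<Rightarrow> ('w \<Rightarrow> enat) \<Rightarrow> (nat \<Rightarrow> 'w \<Rightarrow> real^2) \<Rightarrow> bool" where
  "point_enumeration M \<Phi> N X \<longleftrightarrow>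
     N \<in> measurable M (count_space UNIV) \<and>
     (\<forall>n. X n \<in> borel_measurable M) \<and>
     (\<forall>\<omega>\<in>space M. bij_betw (\<lambda>n. X n \<omega>) {n. enat n < N \<omega>} (\<Phi> \<omega>))"

definition points_algebra ::
  "'w measure \<Rightarrow> ('w \<Rightarrow> enat) \<Rightarrow> (nat \<Rightarrow> 'w \<Rightarrow> real^2) \<Rightarrow> 'w measure" where
  "points_algebra M N X =
     vimage_algebra (space M) (\<lambda>\<omega>. (N \<omega>, \<lambda>n. X n \<omega>))
       (count_space UNIV \<Otimes>\<^sub>M (\<Pi>\<^sub>M n\<in>UNIV. borel))"

definition timer_seq ::
  "('w \<Rightarrow> enat) \<Rightarrow> (nat \<Rightarrow> 'w \<Rightarrow> real^2) \<Rightarrow> ('w \<Rightarrow> real^2 \<Rightarrow> real) \<Rightarrow> nat \<Rightarrow> 'w \<Rightarrow> real" where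
  "timer_seq N X t n \<omega> = (if enat n < N \<omega> then t \<omega> (X n \<omega>) else 0)"

definition points_timers_algebra ::
  "'w measure \<Rightarrow> ('w \<Rightarrow> enat) \<Rightarrow> (nat \<Rightarrow> 'w \<Rightarrow> real^2) \<Rightarrow> ('w \<Rightarrow> real^2 \<Rightarrow> real) \<Rightarrow> 'w measure" where
  "points_timers_algebra M N X t =
     vimage_algebra (space M) (\<lambda>\<omega>. (N \<omega>, \<lambda>n. X n \<omega>, \<lambda>n. timer_seq N X t n \<omega>))
       (count_space UNIV \<Otimes>\<^sub>M (\<Pi>\<^sub>M n\<in>UNIV. borel) \<Otimes>\<^sub>M (\<Pi>\<^sub>M n\<in>UNIV. borel))"

definition edge_event ::
  "'w measure \<Rightarrow> ('w \<Rightarrow> enat) \<Rightarrow> (nat \<Rightarrow> 'w \<Rightarrow> real^2) \<Rightarrow> ('w \<Rightarrow> real^2 \<Rightarrow> real^2 \<Rightarrow> bool)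
     \<Rightarrow> nat \<Rightarrow> nat \<Rightarrow> 'w set" where
  "edge_event M N X C i j =
     {\<omega> \<in> space M. enat i < N \<omega> \<and> enat j < N \<omega> \<and> C \<omega> (X i \<omega>) (X j \<omega>)}"

text \<open>
  Given the points, the timers are i.i.d. uniform: on the event that there are at least \<open>k\<close>
  points, the conditional law of the first \<open>k\<close> timers is the \<open>k\<close>-fold product of the uniform law.
\<close>

definition iid_uniform_timers ::
  "'w measure \<Rightarrow> ('w \<Rightarrow> enat) \<Rightarrow> (nat \<Rightarrow> 'w \<Rightarrow> real^2) \<Rightarrow> ('w \<Rightarrow> real^2 \<Rightarrow> real) \<Rightarrow> bool" where
  "iid_uniform_timers M N X t \<longleftrightarrow>
     (\<forall>n. timer_seq N X t n \<in> borel_measurable M) \<and>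
     (\<forall>k D. (\<forall>i<k. D i \<in> sets borel) \<longrightarrow>
        (AE \<omega> in M. enat k \<le> N \<omega> \<longrightarrow>
           real_cond_exp M (points_algebra M N X)
             (indicator {\<omega>' \<in> space M. \<forall>i<k. timer_seq N X t i \<omega>' \<in> D i}) \<omega> =
           (\<Prod>i<k. measure (uniform_measure lborel {0..1}) (D i))))"

text \<open>
  Given points and timers, the edge variables of the unordered pairs \<open>{X i, X j}\<close>, indexed by
  \<open>i < j\<close>, are independent with success probability \<open>h (X i) (X j)\<close>. As for \<^const>\<open>prob_space.indep_events\<close>,
  independence is the product rule for all finite collections of pairs.
\<close>

definition cond_indep_edges ::
  "'w measure \<Rightarrow> ('w \<Rightarrow> (real^2) set) \<Rightarrow> ('w \<Rightarrow> enat) \<Rightarrow> (nat \<Rightarrow> 'w \<Rightarrow> real^2) \<Rightarrow>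
     ('w \<Rightarrow> real^2 \<Rightarrow> real) \<Rightarrow> ('w \<Rightarrow> real^2 \<Rightarrow> real^2 \<Rightarrow> bool) \<Rightarrow> (real^2 \<Rightarrow> real^2 \<Rightarrow> real) \<Rightarrow> bool" where
  "cond_indep_edges M \<Phi> N X t C h \<longleftrightarrow>
     (\<forall>\<omega>\<in>space M. \<forall>x\<in>\<Phi> \<omega>. \<forall>y\<in>\<Phi> \<omega>. x \<noteq> y \<longrightarrow> C \<omega> x y = C \<omega> y x) \<and>
     (\<forall>i j. i < j \<longrightarrow> edge_event M N X C i j \<in> sets M) \<and>
     (\<forall>k. \<forall>S \<subseteq> {(i, j). i < j \<and> j < k}.
        (AE \<omega> in M. enat k \<le> N \<omega> \<longrightarrow>
           real_cond_exp M (points_timers_algebra M N X t)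
             (indicator {\<omega>' \<in> space M. \<forall>(i, j)\<in>S. \<omega>' \<in> edge_event M N X C i j}) \<omega> =
           (\<Prod>(i, j)\<in>S. h (X i \<omega>) (X j \<omega>))))"

definition matern_marks ::
  "'w measure \<Rightarrow> ('w \<Rightarrow> (real^2) set) \<Rightarrow> ('w \<Rightarrow> real^2 \<Rightarrow> real) \<Rightarrow>
     ('w \<Rightarrow> real^2 \<Rightarrow> real^2 \<Rightarrow> bool) \<Rightarrow> (real^2 \<Rightarrow> real^2 \<Rightarrow> real) \<Rightarrow> bool" where
  "matern_marks M \<Phi> t C h \<longleftrightarrow>
     (\<exists>N X. point_enumeration M \<Phi> N X \<and> iid_uniform_timers M N X t \<and>
            cond_indep_edges M \<Phi> N X t C h)"

text \<open>
  Products over infinite sets: \<^const>\<open>prod\<close> is \<open>1\<close> on every infinite set, so the product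
  is taken as the limit of the net of finite partial products, in analogy with \<^const>\<open>has_sum\<close>.
  For factors in \<open>{0, 1}\<close> the limit always exists: it is \<open>0\<close> if some factor vanishes, else \<open>1\<close>.
\<close>

definition has_set_prod :: "('a \<Rightarrow> real) \<Rightarrow> real \<Rightarrow> 'a set \<Rightarrow> bool" where
  "has_set_prod f p A \<longleftrightarrow> (prod f \<longlongrightarrow> p) (finite_subsets_at_top A)"

text \<open>A family indexed by \<open>P\<close> is represented by an extensional function on \<open>P\<close>.\<close>

definition thinning_indicators ::
  "'a set \<Rightarrow> ('a \<Rightarrow> real) \<Rightarrow> ('a \<Rightarrow> 'a \<Rightarrow> bool) \<Rightarrow> ('a \<Rightarrow> real) \<Rightarrow> bool" where
  "thinning_indicators P t C e \<longleftrightarrow>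
     e \<in> P \<rightarrow>\<^sub>E {0, 1} \<and>
     (\<forall>x\<in>P. has_set_prod (\<lambda>y. 1 - e y * of_bool (C x y)) (e x) {y \<in> P. t y < t x})"

text \<open>
  The two conditioning algebras are sub-algebras of \<open>M\<close>, so that \<^const>\<open>real_cond_exp\<close> above is
  the genuine conditional expectation.
\<close>

lemma subalgebra_points_algebra:
  assumes "point_enumeration M \<Phi> N X"
  shows "subalgebra M (points_algebra M N X)"
proof -
  have [measurable]: "N \<in> measurable M (count_space UNIV)" "\<And>n. X n \<in> borel_measurable M"
    using assms by (auto simp: point_enumeration_def)
  have "(\<lambda>\<omega>. (N \<omega>, \<lambda>n. X n \<omega>)) \<in> measurable M (count_space UNIV \<Otimes>\<^sub>M (\<Pi>\<^sub>M n\<in>UNIV. borel))"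
    by (intro measurable_Pair measurable_PiM_single') auto
  then show ?thesis
    unfolding subalgebra_def points_algebra_def
    by (auto simp: sets_vimage_algebra2 space_pair_measure space_PiM measurable_sets)
qed

lemma subalgebra_points_timers_algebra:
  assumes "point_enumeration M \<Phi> N X" and "iid_uniform_timers M N X t"
  shows "subalgebra M (points_timers_algebra M N X t)"
proof -
  have [measurable]: "N \<in> measurable M (count_space UNIV)" "\<And>n. X n \<in> borel_measurable M"
    "\<And>n. timer_seq N X t n \<in> borel_measurable M"
    using assms by (auto simp: point_enumeration_def iid_uniform_timers_def)
  have "(\<lambda>\<omega>. (N \<omega>, \<lambda>n. X n \<omega>, \<lambda>n. timer_seq N X t n \<omega>))
      \<in> measurable M (count_space UNIV \<Otimes>\<^sub>M (\<Pi>\<^sub>M n\<in>UNIV. borel) \<Otimes>\<^sub>M (\<Pi>\<^sub>M n\<in>UNIV. borel))"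
    by (intro measurable_Pair measurable_PiM_single') auto
  then show ?thesis
    unfolding subalgebra_def points_timers_algebra_def
    by (auto simp: sets_vimage_algebra2 space_pair_measure space_PiM measurable_sets)
qed

lemma has_set_prod_zero_one:
  assumes "\<And>y. y \<in> A \<Longrightarrow> f y \<in> {0, 1}"
  shows "has_set_prod f (if \<exists>y\<in>A. f y = 0 then 0 else 1) A"
proof (cases "\<exists>y\<in>A. f y = 0")
  case True
  then obtain y where y: "y \<in> A" "f y = 0" by blast
  have "eventually (\<lambda>F. prod f F = 0) (finite_subsets_at_top A)"
    unfolding eventually_finite_subsets_at_top
    by (rule exI[of _ "{y}"]) (use y in \<open>auto intro: prod_zero\<close>)
  then show ?thesis using True by (simp add: has_set_prod_def tendsto_eventually)
next
  case False
  then have "f y = 1" if "y \<in> A" for y using assms that by blast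
  then have "eventually (\<lambda>F. prod f F = 1) (finite_subsets_at_top A)"
    unfolding eventually_finite_subsets_at_top
    by (intro exI[of _ "{}"]) (auto intro: prod.neutral)
  then show ?thesis using False by (simp add: has_set_prod_def tendsto_eventually)
qed

end

theory Submission
  imports Defs
begin

text \<open>
  The indicators are determined by well-founded recursion as soon as the relation
  ``\<open>y\<close> is a \<open>C\<close>-neighbour of \<open>x\<close> with a smaller timer'' admits no infinite descending chain. Along such
  a chain the timers decrease, so a tail of it has all its timers in one set \<open>D\<close> of a partition into
  sets of uniform measure \<open>p \<le> 1 / m\<close>. By the conditional laws of timers and edges and the bound
  \<open>lam ^ (n + 1)\<close> times Lebesgue measure for the factorial moment measure, the expected number of chains of
  \<open>n\<close> steps that start in a bounded set \<open>B\<close> and have all timers in \<open>D\<close> is at most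
  \<open>lam * p * measure B * (lam * p * H) ^ n\<close>, where \<open>H\<close> is the integral of \<open>h 0\<close>. For \<open>m > lam * H\<close> this
  tends to \<open>0\<close>, so almost surely no such infinite chain exists.
\<close>

section \<open>Thinning indicators and descending chains\<close>

text \<open>Each factor \<open>1 - e y * of_bool (C x y)\<close> is 0 or 1, so the finite products
  converge to 0 if some factor vanishes and to 1 otherwise. Uniqueness of limits turns this into an
  equation for \<open>e x\<close>.\<close>

lemma thinning_indicators_iff:
  "thinning_indicators P t C e \<longleftrightarrow>
     e \<in> P \<rightarrow>\<^sub>E {0, 1} \<and>
     (\<forall>x\<in>P. e x = (if \<exists>y\<in>P. t y < t x \<and> C x y \<and> e y = 1 then 0 else 1))"
proof (cases "e \<in> P \<rightarrow>\<^sub>E {0, 1}")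
  case True
  have "has_set_prod (\<lambda>y. 1 - e y * of_bool (C x y)) (e x) {y \<in> P. t y < t x} \<longleftrightarrow>
      e x = (if \<exists>y\<in>P. t y < t x \<and> C x y \<and> e y = 1 then 0 else 1)" if "x \<in> P" for x
  proof -
    let ?f = "\<lambda>y. 1 - e y * of_bool (C x y)" and ?A = "{y \<in> P. t y < t x}"
    let ?v = "if \<exists>y\<in>P. t y < t x \<and> C x y \<and> e y = 1 then 0 else 1 :: real"
    have "has_set_prod ?f (if \<exists>y\<in>?A. ?f y = 0 then 0 else 1) ?A"
      by (rule has_set_prod_zero_one) (use True in \<open>fastforce simp: PiE_iff\<close>)
    moreover have "(\<exists>y\<in>?A. ?f y = 0) \<longleftrightarrow> (\<exists>y\<in>P. t y < t x \<and> C x y \<and> e y = 1)"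
      by (auto simp: of_bool_def)
    ultimately have v: "has_set_prod ?f ?v ?A"
      by (simp only:)
    show ?thesis
    proof
      assume "has_set_prod ?f (e x) ?A"
      with v show "e x = ?v"
        unfolding has_set_prod_def
        by (rule tendsto_unique[OF finite_subsets_at_top_neq_bot, rotated])
    next
      assume "e x = ?v"
      with v show "has_set_prod ?f (e x) ?A" by (simp only:)
    qed
  qed
  then show ?thesis by (simp add: thinning_indicators_def)
qed (simp add: thinning_indicators_def)

text \<open>The equation at \<open>x\<close> involves only values at \<open>C\<close>-neighbours
  with smaller timers. Well-founded recursion therefore yields a solution, and well-founded
  induction its uniqueness on \<open>P\<close>; off \<open>P\<close> extensionality forces
  \<open>undefined\<close>.\<close>

lemma ex1_thinning_indicators:
  assumes wf: "wf {(y, x). x \<in> P \<and> y \<in> P \<and> t y < t x \<and> C x y}"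
  shows "\<exists>!e. thinning_indicators P t C e"
proof (rule ex_ex1I)
  let ?R = "{(y, x). x \<in> P \<and> y \<in> P \<and> t y < t x \<and> C x y}"
  define F where "F e x =
    (if x \<in> P then if \<exists>y\<in>P. t y < t x \<and> C x y \<and> e y = 1 then 0 else 1 else undefined :: real)"
    for e :: "'a \<Rightarrow> real" and x
  define e where "e = wfrec ?R F"
  have e_eq: "e x = F e x" for x
  proof -
    have "e x = F (cut e ?R x) x"
      unfolding e_def by (rule wfrec[OF wf])
    also have "\<dots> = F e x"
    proof -
      have "(\<exists>y\<in>P. t y < t x \<and> C x y \<and> cut e ?R x y = 1) \<longleftrightarrow> (\<exists>y\<in>P. t y < t x \<and> C x y \<and> e y = 1)"
        if "x \<in> P"
        using that by (intro bex_cong) (auto simp: cut_def)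
      then show ?thesis by (simp add: F_def)
    qed
    finally show ?thesis .
  qed
  have "e x \<in> {0, 1}" if "x \<in> P" for x
    using that by (subst e_eq) (simp add: F_def)
  moreover have "e x = undefined" if "x \<notin> P" for x
    using that by (subst e_eq) (simp add: F_def)
  ultimately have "e \<in> P \<rightarrow>\<^sub>E {0, 1}"
    by (simp add: PiE_iff extensional_def)
  moreover have "e x = (if \<exists>y\<in>P. t y < t x \<and> C x y \<and> e y = 1 then 0 else 1)" if "x \<in> P" for x
    using that by (subst e_eq) (simp add: F_def)
  ultimately show "\<exists>e. thinning_indicators P t C e"
    unfolding thinning_indicators_iff by blast
next
  fix e e' assume e: "thinning_indicators P t C e" and e': "thinning_indicators P t C e'"
  have "e x = e' x" if "x \<in> P" for x
    using wf that
  proof (induction x)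
    case (less x)
    have "e y = e' y" if "y \<in> P" "t y < t x" "C x y" for y
      using less that by blast
    then have iff: "(\<exists>y\<in>P. t y < t x \<and> C x y \<and> e y = 1) \<longleftrightarrow>
        (\<exists>y\<in>P. t y < t x \<and> C x y \<and> e' y = 1)"
      by (intro bex_cong) auto
    have "e x = (if \<exists>y\<in>P. t y < t x \<and> C x y \<and> e y = 1 then 0 else 1)"
      using e less.prems unfolding thinning_indicators_iff by blast
    moreover have "e' x = (if \<exists>y\<in>P. t y < t x \<and> C x y \<and> e' y = 1 then 0 else 1)"
      using e' less.prems unfolding thinning_indicators_iff by blast
    ultimately show ?case
      by (simp only: iff)
  qed
  moreover have "e \<in> P \<rightarrow>\<^sub>E {0, 1}" "e' \<in> P \<rightarrow>\<^sub>E {0, 1}"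
    using e e' unfolding thinning_indicators_def by blast+
  ultimately show "e = e'"
    by (intro PiE_ext)
qed

text \<open>
  Level \<open>0\<close> collects the negative timers, so that every decreasing sequence of reals ends up in
  a single level and the null event of a timer outside \<open>[0, 1]\<close> needs no separate treatment.
\<close>

definition timer_level :: "nat \<Rightarrow> real \<Rightarrow> nat" where
  "timer_level m s = (if s < 0 then 0 else Suc (nat \<lfloor>m * s\<rfloor>))"

lemma timer_level_mono: "s \<le> s' \<Longrightarrow> timer_level m s \<le> timer_level m s'"
  by (auto simp: timer_level_def intro!: nat_mono floor_mono mult_left_mono)

text \<open>A least value is attained; from there on the sequence cannot fall and, being antitone,
  cannot rise.\<close>

lemma antimono_nat_eventually_const:
  fixes f :: "nat \<Rightarrow> nat"
  assumes "antimono f"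
  obtains n0 where "\<And>k. f (n0 + k) = f n0"
proof -
  obtain n0 where n0: "\<And>n. f n0 \<le> f n"
    using ex_has_least_nat[of "\<lambda>_. True" 0 f] by auto
  show thesis
    by (rule that[of n0]) (use n0 assms in \<open>auto intro: antisym simp: antimono_def\<close>)
qed

text \<open>Levels are natural numbers that do not increase along the chain, so they become
  constant; the initial segment is cut off.\<close>

lemma descending_chain_in_timer_level:
  assumes "\<not> wf {(y, x). x \<in> P \<and> y \<in> P \<and> t y < t x \<and> C x y}"
  obtains f a where "\<And>k. f k \<in> P" "\<And>k. t (f (Suc k)) < t (f k)" "\<And>k. C (f k) (f (Suc k))"
    "\<And>k. timer_level m (t (f k)) = a"
proof -
  obtain f where f: "\<And>i. f i \<in> P" "\<And>i. t (f (Suc i)) < t (f i)" "\<And>i. C (f i) (f (Suc i))"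
    using assms unfolding wf_iff_no_infinite_down_chain by auto
  have "antimono (\<lambda>i. timer_level m (t (f i)))"
    unfolding antimono_iff_le_Suc by (intro allI timer_level_mono[OF less_imp_le[OF f(2)]])
  then obtain n0 where "\<And>k. timer_level m (t (f (n0 + k))) = timer_level m (t (f n0))"
    by (rule antimono_nat_eventually_const) blast
  then show thesis
    using f by (intro that[of "\<lambda>k. f (n0 + k)" "timer_level m (t (f n0))"]) simp_all
qed

lemma timer_level_measurable [measurable]: "timer_level m \<in> borel \<rightarrow>\<^sub>M count_space UNIV"
  unfolding timer_level_def by measurable

lemma measure_timer_level:
  assumes "0 < m"
  shows "measure (uniform_measure lborel {0..1}) {s. timer_level m s = a} \<le> 1 / m"
proof -
  have [measurable]: "{s. timer_level m s = a} \<in> sets borel" by measurable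
  have "measure (uniform_measure lborel {0..1}) {s. timer_level m s = a} =
      measure lborel ({0..1} \<inter> {s. timer_level m s = a})"
    by (subst measure_uniform_measure) auto
  \<comment> \<open>For \<open>a = 0\<close> the left-hand set is empty, since level 0 holds only
    negative timers; the interval has length \<open>1 / m\<close> in every case.\<close>
  also have "\<dots> \<le> measure lborel {(real a - 1) / m .. real a / m}"
  proof (rule measure_mono_fmeasurable)
    show "{0..1} \<inter> {s. timer_level m s = a} \<subseteq> {(real a - 1) / m .. real a / m}"
    proof
      fix s assume "s \<in> {0..1} \<inter> {s. timer_level m s = a}"
      then have "0 \<le> s" and a: "a = Suc (nat \<lfloor>m * s\<rfloor>)"
        by (auto simp: timer_level_def)
      then have "real (nat \<lfloor>m * s\<rfloor>) = of_int \<lfloor>m * s\<rfloor>"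
        by simp
      then have "real a - 1 \<le> m * s" "m * s \<le> real a"
        unfolding a by linarith+
      then show "s \<in> {(real a - 1) / m .. real a / m}"
        using assms by (simp add: field_simps)
    qed
  qed (auto simp: fmeasurable_def emeasure_lborel_Icc_eq)
  also have "\<dots> = 1 / m"
    using assms by (subst measure_lborel_Icc) (simp_all add: field_simps)
  finally show ?thesis .
qed

section \<open>Factorial moments of the Poisson process\<close>

text \<open>The term for \<open>k = 0\<close> vanishes and otherwise
  \<open>k * r ^ k / fact k = r * r ^ (k - 1) / fact (k - 1)\<close>, so the series of the mean is
  \<open>r * exp (- r)\<close> times the exponential series.\<close>

lemma (in prob_space) nn_integral_poisson_count:
  fixes c :: "'a \<Rightarrow> nat"
  assumes c: "c \<in> M \<rightarrow>\<^sub>M count_space UNIV" and "0 \<le> r"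
    and prob: "\<And>k. prob {\<omega> \<in> space M. c \<omega> = k} = r ^ k / fact k * exp (- r)"
  shows "(\<integral>\<^sup>+\<omega>. of_nat (c \<omega>) \<partial>M) = ennreal r"
proof -
  have [measurable]: "c \<in> M \<rightarrow>\<^sub>M count_space UNIV" by fact
  \<comment> \<open>The count is written as a sum over its possible values, so that sum and
    expectation can be exchanged.\<close>
  have "(\<integral>\<^sup>+\<omega>. of_nat (c \<omega>) \<partial>M) =
      (\<integral>\<^sup>+\<omega>. \<integral>\<^sup>+k. of_nat k * indicator {c \<omega>} k \<partial>count_space UNIV \<partial>M)"
    by (intro nn_integral_cong) (subst nn_integral_indicator_singleton, auto)
  also have "\<dots> = (\<integral>\<^sup>+\<omega>. \<integral>\<^sup>+k. of_nat k * indicator {\<omega> \<in> space M. c \<omega> = k} \<omega> \<partial>count_space UNIV \<partial>M)"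
    by (intro nn_integral_cong) (auto simp: indicator_def)
  also have "\<dots> = (\<integral>\<^sup>+k. \<integral>\<^sup>+\<omega>. of_nat k * indicator {\<omega> \<in> space M. c \<omega> = k} \<omega> \<partial>M \<partial>count_space UNIV)"
    by (rule nn_integral_count_space_nn_integral) auto
  also have "\<dots> = (\<integral>\<^sup>+k. of_nat k * emeasure M {\<omega> \<in> space M. c \<omega> = k} \<partial>count_space UNIV)"
    by (intro nn_integral_cong nn_integral_cmult_indicator) auto
  also have "\<dots> = (\<Sum>k. of_nat k * emeasure M {\<omega> \<in> space M. c \<omega> = k})"
    by (rule nn_integral_count_space_nat)
  also have "\<dots> = (\<Sum>k. ennreal (real k * (r ^ k / fact k * exp (- r))))"
    using \<open>0 \<le> r\<close>
    by (intro suminf_cong) (simp add: emeasure_eq_measure prob ennreal_of_nat_eq_real_of_nat flip: ennreal_mult)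
  also have "\<dots> = ennreal r"
  proof (rule suminf_ennreal_eq)
    have "(\<lambda>k. r * exp (- r) * (r ^ k / fact k)) sums (r * exp (- r) * exp r)"
      using exp_converges[of r] by (intro sums_mult) (simp add: field_simps)
    moreover have "r * exp (- r) * (r ^ k / fact k) =
        real (Suc k) * (r ^ Suc k / fact (Suc k) * exp (- r))" for k
      unfolding fact_Suc power_Suc by (simp add: divide_simps del: of_nat_Suc)
    moreover have "r * exp (- r) * exp r = r"
      by (simp add: mult.assoc flip: exp_add)
    ultimately have "(\<lambda>k. real (Suc k) * (r ^ Suc k / fact (Suc k) * exp (- r))) sums r"
      by (simp only:)
    then show "(\<lambda>k. real k * (r ^ k / fact k * exp (- r))) sums r"
      by (subst (asm) sums_Suc_iff) simp
  qed (use \<open>0 \<le> r\<close> in auto)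
  finally show ?thesis .
qed

locale enumerated_poisson =
  fixes M :: "'w measure" and lam :: real and \<Phi> :: "'w \<Rightarrow> (real^2) set"
    and N :: "'w \<Rightarrow> enat" and X :: "nat \<Rightarrow> 'w \<Rightarrow> real^2"
  assumes poisson: "homogeneous_poisson_process M lam \<Phi>"
    and enumeration: "point_enumeration M \<Phi> N X"

sublocale enumerated_poisson \<subseteq> prob_space M
  using poisson by (simp add: homogeneous_poisson_process_def)

context enumerated_poisson
begin

lemma lam_nonneg: "0 \<le> lam"
  using poisson by (simp add: homogeneous_poisson_process_def)

lemma N_measurable [measurable]: "N \<in> M \<rightarrow>\<^sub>M count_space UNIV"
  and X_measurable [measurable]: "X n \<in> borel_measurable M"
  using enumeration by (auto simp: point_enumeration_def)

lemma X_inj: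
  assumes "\<omega> \<in> space M" "enat i < N \<omega>" "enat j < N \<omega>" "X i \<omega> = X j \<omega>"
  shows "i = j"
  using enumeration assms unfolding point_enumeration_def bij_betw_def inj_on_def by blast

lemma X_in: "\<omega> \<in> space M \<Longrightarrow> enat i < N \<omega> \<Longrightarrow> X i \<omega> \<in> \<Phi> \<omega>"
  using enumeration unfolding point_enumeration_def bij_betw_def by blast

lemma X_surj:
  assumes "\<omega> \<in> space M" "x \<in> \<Phi> \<omega>"
  obtains i where "enat i < N \<omega>" "X i \<omega> = x"
proof -
  have "x \<in> (\<lambda>n. X n \<omega>) ` {n. enat n < N \<omega>}"
    using enumeration assms unfolding point_enumeration_def bij_betw_def by blast
  then show thesis using that by blast
qed

lemma card_measurable [measurable]:
  "B \<in> sets borel \<Longrightarrow> bounded B \<Longrightarrow> (\<lambda>\<omega>. card (\<Phi> \<omega> \<inter> B)) \<in> M \<rightarrow>\<^sub>M count_space UNIV"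
  using poisson by (simp add: homogeneous_poisson_process_def)

lemma nn_integral_card:
  assumes "B \<in> sets borel" "bounded B"
  shows "(\<integral>\<^sup>+\<omega>. of_nat (card (\<Phi> \<omega> \<inter> B)) \<partial>M) = ennreal lam * emeasure lborel B"
proof -
  have "(\<integral>\<^sup>+\<omega>. of_nat (card (\<Phi> \<omega> \<inter> B)) \<partial>M) = ennreal (lam * measure lborel B)"
    using assms poisson lam_nonneg
    by (intro nn_integral_poisson_count) (auto simp: homogeneous_poisson_process_def)
  also have "\<dots> = ennreal lam * emeasure lborel B"
    using emeasure_bounded_finite[OF \<open>bounded B\<close>] lam_nonneg
    by (simp add: ennreal_mult emeasure_eq_ennreal_measure top.not_eq_extremum)
  finally show ?thesis .
qed

text \<open>The enumeration is a bijection from the indices below \<open>N \<omega>\<close> onto the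
  points, so points are counted through their indices. As an integral over
  \<open>count_space\<close> the count is open to Tonelli's theorem.\<close>

lemma card_eq_nn_integral:
  assumes "\<omega> \<in> space M" "bounded B"
  shows "of_nat (card (\<Phi> \<omega> \<inter> B)) =
    (\<integral>\<^sup>+j. of_bool (enat j < N \<omega> \<and> X j \<omega> \<in> B) \<partial>count_space UNIV)"
proof -
  let ?J = "{j. enat j < N \<omega> \<and> X j \<omega> \<in> B}"
  have bij: "bij_betw (\<lambda>j. X j \<omega>) ?J (\<Phi> \<omega> \<inter> B)"
    using X_inj[OF assms(1)] X_in[OF assms(1)]
    by (auto simp: bij_betw_def inj_on_def elim!: X_surj[OF assms(1)])
  moreover have "finite (\<Phi> \<omega> \<inter> B)"
    using poisson assms by (simp add: homogeneous_poisson_process_def)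
  ultimately have "emeasure (count_space UNIV) ?J = of_nat (card (\<Phi> \<omega> \<inter> B))"
    using bij_betw_finite[OF bij] bij_betw_same_card[OF bij] by (simp add: emeasure_count_space)
  moreover have "(\<integral>\<^sup>+j. of_bool (enat j < N \<omega> \<and> X j \<omega> \<in> B) \<partial>count_space UNIV) =
      (\<integral>\<^sup>+j. indicator ?J j \<partial>count_space UNIV)"
    by (intro nn_integral_cong) (simp add: indicator_def)
  ultimately show ?thesis by simp
qed

end

lemma sigma_finite_lborel_product: "product_sigma_finite (\<lambda>_::nat. lborel :: (real^2) measure)"
  by unfold_locales

section \<open>Expectations of sums over tuples of points\<close>

context enumerated_poisson
begin

text \<open>
  An integral over \<open>tuple_space n\<close> is the expectation of a sum over \<open>(n + 1)\<close>-tuples of indices.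
\<close>

definition tuple_space :: "nat \<Rightarrow> ((nat \<Rightarrow> nat) \<times> 'w) measure" where
  "tuple_space n = count_space ({..n} \<rightarrow>\<^sub>E UNIV) \<Otimes>\<^sub>M M"

text \<open>The restriction to \<open>{..n}\<close> puts the tuple into the space of the finite
  product measure. Entries at indices beyond the number of points are arbitrary;
  \<open>present\<close> masks them.\<close>

definition sample :: "nat \<Rightarrow> (nat \<Rightarrow> nat) \<times> 'w \<Rightarrow> nat \<Rightarrow> real^2" where
  "sample n p = (\<lambda>k\<in>{..n}. X (fst p k) (snd p))"

definition present :: "nat \<Rightarrow> (nat \<Rightarrow> nat) \<times> 'w \<Rightarrow> bool" where
  "present n p \<longleftrightarrow> (\<forall>k\<le>n. enat (fst p k) < N (snd p))"

lemma countable_tuples: "countable ({..n::nat} \<rightarrow>\<^sub>E (UNIV :: nat set))"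
  by (intro countable_PiE) auto

lemma space_tuple_space: "space (tuple_space n) = ({..n} \<rightarrow>\<^sub>E UNIV) \<times> space M"
  by (simp add: tuple_space_def space_pair_measure)

text \<open>There are countably many index tuples, so joint measurability reduces to measurability
  for each fixed tuple.\<close>

lemma sample_measurable [measurable]: "sample n \<in> tuple_space n \<rightarrow>\<^sub>M (\<Pi>\<^sub>M k\<in>{..n}. lborel)"
  unfolding tuple_space_def
proof (rule measurable_pair_measure_countable1[OF countable_tuples])
  fix i
  show "(\<lambda>\<omega>. sample n (i, \<omega>)) \<in> M \<rightarrow>\<^sub>M (\<Pi>\<^sub>M k\<in>{..n}. lborel)"
    unfolding sample_def by (intro measurable_restrict) simp
qed

lemma present_measurable [measurable]: "Measurable.pred (tuple_space n) (present n)"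
  unfolding tuple_space_def
proof (rule measurable_pair_measure_countable1[OF countable_tuples])
  fix i
  show "Measurable.pred M (\<lambda>\<omega>. present n (i, \<omega>))"
    unfolding present_def by simp
qed

lemma nn_integral_tuple_space:
  assumes "f \<in> borel_measurable (tuple_space n)"
  shows "(\<integral>\<^sup>+p. f p \<partial>tuple_space n) = (\<integral>\<^sup>+i. \<integral>\<^sup>+\<omega>. f (i, \<omega>) \<partial>M \<partial>count_space ({..n} \<rightarrow>\<^sub>E UNIV))"
  using assms unfolding tuple_space_def by (rule nn_integral_fst[symmetric])

text \<open>Counts in disjoint bounded sets are independent, so the expectation factorises into
  Poisson means.\<close>

lemma nn_integral_prod_card:
  fixes n :: nat
  assumes B: "\<And>k. k \<le> n \<Longrightarrow> B k \<in> sets borel" "\<And>k. k \<le> n \<Longrightarrow> bounded (B k)"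
    and disj: "disjoint_family_on B {..n}"
  shows "(\<integral>\<^sup>+\<omega>. (\<Prod>k\<le>n. of_nat (card (\<Phi> \<omega> \<inter> B k))) \<partial>M) = (\<Prod>k\<le>n. ennreal lam * emeasure lborel (B k))"
proof -
  have "indep_vars (\<lambda>_. count_space UNIV) (\<lambda>k \<omega>. card (\<Phi> \<omega> \<inter> B k)) {..n}"
  proof -
    have "\<forall>(n::nat) B. (\<forall>i<n. B i \<in> sets borel \<and> bounded (B i)) \<and> disjoint_family_on B {..<n} \<longrightarrow>
        indep_vars (\<lambda>_. count_space UNIV) (\<lambda>i \<omega>. card (\<Phi> \<omega> \<inter> B i)) {..<n}"
      using poisson unfolding homogeneous_poisson_process_def by blast
    \<comment> \<open>Independence is postulated over \<open>{..<n}\<close>; the instance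
      \<open>Suc n\<close> covers \<open>{..n}\<close>.\<close>
    from this[rule_format, of "Suc n" B] show ?thesis
      using B disj by (simp add: less_Suc_eq_le lessThan_Suc_atMost)
  qed
  then have "indep_vars (\<lambda>_. borel) (\<lambda>k \<omega>. of_nat (card (\<Phi> \<omega> \<inter> B k)) :: ennreal) {..n}"
    by (rule indep_vars_compose2) simp
  then have "(\<integral>\<^sup>+\<omega>. (\<Prod>k\<le>n. of_nat (card (\<Phi> \<omega> \<inter> B k))) \<partial>M) =
      (\<Prod>k\<le>n. \<integral>\<^sup>+\<omega>. of_nat (card (\<Phi> \<omega> \<inter> B k)) \<partial>M)"
    by (intro indep_vars_nn_integral) auto
  also have "\<dots> = (\<Prod>k\<le>n. ennreal lam * emeasure lborel (B k))"
    using B by (intro prod.cong refl nn_integral_card) auto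
  finally show ?thesis .
qed

text \<open>The indicator of a box is a product of indicators in one coordinate each, so the sum
  over all index tuples is the product of the counts in the sets \<open>B k\<close>. Disjointness
  makes these counts independent.\<close>

lemma nn_integral_tuples_box:
  assumes B: "\<And>k. k \<le> n \<Longrightarrow> B k \<in> sets borel" "\<And>k. k \<le> n \<Longrightarrow> bounded (B k)"
    and disj: "disjoint_family_on B {..n}"
  shows "(\<integral>\<^sup>+p. of_bool (present n p) * indicator (Pi\<^sub>E {..n} B) (sample n p) \<partial>tuple_space n) =
    (\<Prod>k\<le>n. ennreal lam * emeasure lborel (B k))"
proof -
  interpret counts: product_sigma_finite "\<lambda>_::nat. count_space (UNIV :: nat set)"
    by (intro product_sigma_finite.intro sigma_finite_measure_count_space)
  let ?q = "\<lambda>\<omega> k j. of_bool (enat j < N \<omega> \<and> X j \<omega> \<in> B k) :: ennreal"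
  have [measurable]: "Pi\<^sub>E {..n} B \<in> sets (\<Pi>\<^sub>M k\<in>{..n}. lborel)"
    using B by (intro sets_PiM_I_finite) auto
  have [measurable]: "Measurable.pred M (\<lambda>\<omega>. X j \<omega> \<in> B k)" if "k \<le> n" for j k
    using B(1)[OF that] by measurable
  have "(\<integral>\<^sup>+p. of_bool (present n p) * indicator (Pi\<^sub>E {..n} B) (sample n p) \<partial>tuple_space n) =
      (\<integral>\<^sup>+i. \<integral>\<^sup>+\<omega>. of_bool (present n (i, \<omega>)) * indicator (Pi\<^sub>E {..n} B) (sample n (i, \<omega>))
        \<partial>M \<partial>count_space ({..n} \<rightarrow>\<^sub>E UNIV))"
    by (rule nn_integral_tuple_space) measurable
  also have "\<dots> = (\<integral>\<^sup>+i. \<integral>\<^sup>+\<omega>. (\<Prod>k\<le>n. ?q \<omega> k (i k)) \<partial>M \<partial>count_space ({..n} \<rightarrow>\<^sub>E UNIV))"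
  proof (intro nn_integral_cong)
    fix i \<omega>
    show "of_bool (present n (i, \<omega>)) * indicator (Pi\<^sub>E {..n} B) (sample n (i, \<omega>)) =
        (\<Prod>k\<le>n. ?q \<omega> k (i k))"
    proof (cases "\<forall>k\<le>n. enat (i k) < N \<omega> \<and> X (i k) \<omega> \<in> B k")
      case True
      then show ?thesis by (auto simp: present_def sample_def indicator_def)
    next
      case False
      then have "(\<Prod>k\<le>n. ?q \<omega> k (i k)) = 0"
        by (intro prod_zero) auto
      moreover have "of_bool (present n (i, \<omega>)) * indicator (Pi\<^sub>E {..n} B) (sample n (i, \<omega>)) = (0::ennreal)"
        using False by (auto simp: present_def sample_def indicator_def PiE_iff)
      ultimately show ?thesis by simp
    qed
  qed
  also have "\<dots> = (\<integral>\<^sup>+\<omega>. \<integral>\<^sup>+i. (\<Prod>k\<le>n. ?q \<omega> k (i k)) \<partial>count_space ({..n} \<rightarrow>\<^sub>E UNIV) \<partial>M)"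
  proof (rule nn_integral_count_space_nn_integral[OF countable_tuples, symmetric])
    fix i :: "nat \<Rightarrow> nat"
    show "(\<lambda>\<omega>. \<Prod>k\<le>n. ?q \<omega> k (i k)) \<in> borel_measurable M"
      by (intro borel_measurable_prod_ennreal) (auto intro!: measurable_compose[OF _ measurable_of_bool])
  qed
  also have "\<dots> = (\<integral>\<^sup>+\<omega>. (\<Prod>k\<le>n. \<integral>\<^sup>+j. ?q \<omega> k j \<partial>count_space UNIV) \<partial>M)"
  proof (intro nn_integral_cong)
    fix \<omega>
    \<comment> \<open>Counting measure on tuples is the product of counting measures, which turns
      the sum of products into a product of sums.\<close>
    have "(\<integral>\<^sup>+i. (\<Prod>k\<le>n. ?q \<omega> k (i k)) \<partial>count_space ({..n} \<rightarrow>\<^sub>E UNIV)) =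
        (\<integral>\<^sup>+i. (\<Prod>k\<le>n. ?q \<omega> k (i k)) \<partial>(\<Pi>\<^sub>M k\<in>{..n}. count_space UNIV))"
      by (subst count_space_PiM_finite) auto
    also have "\<dots> = (\<Prod>k\<le>n. \<integral>\<^sup>+j. ?q \<omega> k j \<partial>count_space UNIV)"
      by (intro counts.product_nn_integral_prod) auto
    finally show "(\<integral>\<^sup>+i. (\<Prod>k\<le>n. ?q \<omega> k (i k)) \<partial>count_space ({..n} \<rightarrow>\<^sub>E UNIV)) =
        (\<Prod>k\<le>n. \<integral>\<^sup>+j. ?q \<omega> k j \<partial>count_space UNIV)" .
  qed
  also have "\<dots> = (\<integral>\<^sup>+\<omega>. (\<Prod>k\<le>n. of_nat (card (\<Phi> \<omega> \<inter> B k))) \<partial>M)"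
    using B(2) by (intro nn_integral_cong prod.cong refl card_eq_nn_integral[symmetric]) auto
  also have "\<dots> = (\<Prod>k\<le>n. ennreal lam * emeasure lborel (B k))"
    by (rule nn_integral_prod_card) (use assms in auto)
  finally show ?thesis .
qed

text \<open>
  On tuples confined to fixed disjoint sets the factorial moment measure is determined by the
  independence of counts, since boxes form a generating \<open>\<pi>\<close>-system.
\<close>

lemma nn_integral_tuples_in_disjoint_sets:
  assumes Q: "\<And>k. k \<le> n \<Longrightarrow> Q k \<in> sets borel" "\<And>k. k \<le> n \<Longrightarrow> bounded (Q k)"
    and disj: "disjoint_family_on Q {..n}"
    and f [measurable]: "f \<in> borel_measurable (\<Pi>\<^sub>M k\<in>{..n}. lborel)"
  shows "(\<integral>\<^sup>+p. of_bool (present n p) * (indicator (Pi\<^sub>E {..n} Q) (sample n p) * f (sample n p)) \<partial>tuple_space n) =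
    (\<integral>\<^sup>+x. ennreal lam ^ Suc n * (indicator (Pi\<^sub>E {..n} Q) x * f x) \<partial>(\<Pi>\<^sub>M k\<in>{..n}. lborel))"
proof -
  interpret P: product_sigma_finite "\<lambda>_::nat. lborel :: (real^2) measure"
    by (rule sigma_finite_lborel_product)
  let ?P = "\<Pi>\<^sub>M k\<in>{..n}. lborel :: (real^2) measure"
  have box [measurable]: "Pi\<^sub>E {..n} Q \<in> sets ?P"
    using Q by (intro sets_PiM_I_finite) auto
  define g :: "(nat \<Rightarrow> nat) \<times> 'w \<Rightarrow> ennreal"
    where "g p = of_bool (present n p) * indicator (Pi\<^sub>E {..n} Q) (sample n p)" for p
  have [measurable]: "g \<in> borel_measurable (tuple_space n)"
    unfolding g_def by measurable
  \<comment> \<open>\<open>\<mu>\<close> is the mean measure of the point tuples in the box of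
    \<open>Q\<close>, and \<open>\<nu>\<close> is its claimed value. The cut to this box makes the
    measures finite and lets every product set be replaced by one with disjoint bounded
    sides.\<close>
  define \<mu> where "\<mu> = distr (density (tuple_space n) g) ?P (sample n)"
  define \<nu> where "\<nu> = density ?P (\<lambda>x. ennreal lam ^ Suc n * indicator (Pi\<^sub>E {..n} Q) x)"
  have sample': "sample n \<in> density (tuple_space n) g \<rightarrow>\<^sub>M ?P"
    by simp
  have rect: "emeasure \<mu> (Pi\<^sub>E {..n} A) = (\<Prod>k\<le>n. ennreal lam * emeasure lborel (A k \<inter> Q k))"
    if A: "\<And>k. k \<in> {..n} \<Longrightarrow> A k \<in> sets lborel" for A
  proof -
    have [measurable]: "Pi\<^sub>E {..n} A \<in> sets ?P"
      using A by (intro sets_PiM_I_finite) auto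
    have "emeasure \<mu> (Pi\<^sub>E {..n} A) =
        (\<integral>\<^sup>+p. g p * indicator (sample n -` Pi\<^sub>E {..n} A \<inter> space (tuple_space n)) p \<partial>tuple_space n)"
      unfolding \<mu>_def by (simp add: emeasure_distr[OF sample'] emeasure_density)
    also have "\<dots> = (\<integral>\<^sup>+p. of_bool (present n p) *
        indicator (Pi\<^sub>E {..n} (\<lambda>k. A k \<inter> Q k)) (sample n p) \<partial>tuple_space n)"
      by (intro nn_integral_cong) (auto simp: g_def indicator_def PiE_iff)
    also have "\<dots> = (\<Prod>k\<le>n. ennreal lam * emeasure lborel (A k \<inter> Q k))"
    proof (rule nn_integral_tuples_box)
      show "disjoint_family_on (\<lambda>k. A k \<inter> Q k) {..n}"
        using disj unfolding disjoint_family_on_def by blast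
    qed (use A Q in \<open>auto simp: bounded_Int\<close>)
    finally show ?thesis .
  qed
  have "\<mu> = \<nu>"
  proof (rule measure_eqI_PiM_finite)
    fix A :: "nat \<Rightarrow> (real^2) set" assume A: "\<And>k. k \<in> {..n} \<Longrightarrow> A k \<in> sets lborel"
    have [measurable]: "Pi\<^sub>E {..n} A \<in> sets ?P"
      using A by (intro sets_PiM_I_finite) auto
    have "emeasure \<nu> (Pi\<^sub>E {..n} A) = (\<integral>\<^sup>+x. ennreal lam ^ Suc n *
        indicator (Pi\<^sub>E {..n} (\<lambda>k. A k \<inter> Q k)) x \<partial>?P)"
      unfolding \<nu>_def
      by (simp add: emeasure_density) (auto intro!: nn_integral_cong simp: indicator_def PiE_iff)
    also have "\<dots> = ennreal lam ^ Suc n * emeasure ?P (Pi\<^sub>E {..n} (\<lambda>k. A k \<inter> Q k))"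
      using A Q by (intro nn_integral_cmult_indicator sets_PiM_I_finite) auto
    also have "\<dots> = ennreal lam ^ Suc n * (\<Prod>k\<le>n. emeasure lborel (A k \<inter> Q k))"
      using A Q by (subst P.emeasure_PiM) auto
    finally show "emeasure \<mu> (Pi\<^sub>E {..n} A) = emeasure \<nu> (Pi\<^sub>E {..n} A)"
      using A by (subst rect) (auto simp: prod.distrib)
  next
    \<comment> \<open>A constant exhausting sequence suffices because the boundedness of the sets
      \<open>Q k\<close> makes \<open>\<mu>\<close> finite.\<close>
    show "range (\<lambda>_::nat. Pi\<^sub>E {..n} (\<lambda>_. UNIV :: (real^2) set)) \<subseteq> prod_algebra {..n} (\<lambda>_. lborel)"
      by (auto intro!: prod_algebraI_finite)
    show "(\<Union>i::nat. Pi\<^sub>E {..n} (\<lambda>_. UNIV)) = space ?P"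
      by (simp add: space_PiM)
    have "emeasure lborel (Q k) < \<infinity>" if "k \<le> n" for k
      using emeasure_bounded_finite Q(2)[OF that] by blast
    then show "emeasure \<mu> (Pi\<^sub>E {..n} (\<lambda>_. UNIV)) \<noteq> \<infinity>"
      by (subst rect) (auto simp: ennreal_prod_eq_top ennreal_mult_eq_top_iff top.not_eq_extremum)
  qed (auto simp: \<mu>_def \<nu>_def)
  have "(\<integral>\<^sup>+p. g p * f (sample n p) \<partial>tuple_space n) = (\<integral>\<^sup>+x. f x \<partial>\<mu>)"
    unfolding \<mu>_def by (simp add: nn_integral_distr[OF sample'] nn_integral_density)
  also have "\<dots> = (\<integral>\<^sup>+x. ennreal lam ^ Suc n * indicator (Pi\<^sub>E {..n} Q) x * f x \<partial>?P)"
    unfolding \<open>\<mu> = \<nu>\<close> \<nu>_def by (simp add: nn_integral_density)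
  finally show ?thesis
    by (simp add: g_def mult.assoc)
qed

end

section \<open>Grids that separate distinct points\<close>

text \<open>Labels of the half-open grid squares of side \<open>1 / m\<close>; the labels form a
  countable type. For \<open>m = 0\<close> the whole plane is one cell.\<close>

definition cell :: "nat \<Rightarrow> real^2 \<Rightarrow> int^2" where
  "cell m x = (\<chi> j. \<lfloor>real m * x $ j\<rfloor>)"

lemma cell_vimage_measurable [measurable]: "{x. cell m x = c} \<in> sets borel"
  unfolding cell_def vec_eq_iff by simp

lemma cell_measurable [measurable]: "cell m \<in> borel \<rightarrow>\<^sub>M count_space UNIV"
  using cell_vimage_measurable by (simp add: measurable_count_space_eq_countable vimage_def)

lemma cell_vimage_bounded:
  assumes "0 < m"
  shows "bounded {x. cell m x = c}"
proof (rule bounded_subset[OF bounded_cbox])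
  show "{x. cell m x = c} \<subseteq> cbox (\<chi> j. c $ j / m) (\<chi> j. (c $ j + 1) / m)"
  proof
    fix x assume "x \<in> {x. cell m x = c}"
    then have "\<lfloor>real m * x $ j\<rfloor> = c $ j" for j
      by (auto simp: cell_def)
    then have "c $ j \<le> real m * x $ j \<and> real m * x $ j \<le> c $ j + 1" for j
      by (metis floor_correct less_imp_le)
    then show "x \<in> cbox (\<chi> j. c $ j / m) (\<chi> j. (c $ j + 1) / m)"
      using assms by (simp add: mem_box_cart field_simps)
  qed
qed

text \<open>Points with the same label differ by less than \<open>1 / m\<close> in every coordinate,
  which fails for large \<open>m\<close> in a coordinate where \<open>x\<close> and \<open>y\<close>
  differ.\<close>

lemma eventually_cell_neq:
  assumes "x \<noteq> y"
  shows "eventually (\<lambda>m. cell m x \<noteq> cell m y) sequentially"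
proof -
  obtain j where j: "x $ j \<noteq> y $ j"
    using assms by (auto simp: vec_eq_iff)
  obtain m0 :: nat where m0: "1 / \<bar>x $ j - y $ j\<bar> < m0"
    using reals_Archimedean2 by blast
  have "cell m x \<noteq> cell m y" if "m0 \<le> m" for m
  proof
    assume "cell m x = cell m y"
    then have "\<lfloor>real m * x $ j\<rfloor> = \<lfloor>real m * y $ j\<rfloor>"
      by (auto simp: cell_def vec_eq_iff)
    then have "\<bar>real m * x $ j - real m * y $ j\<bar> < 1"
      by linarith
    moreover have "\<bar>real m * x $ j - real m * y $ j\<bar> = real m * \<bar>x $ j - y $ j\<bar>"
      by (simp add: abs_mult flip: right_diff_distrib)
    moreover have "1 < real m0 * \<bar>x $ j - y $ j\<bar>"
      using m0 j by (simp add: field_simps)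
    moreover have "real m0 * \<bar>x $ j - y $ j\<bar> \<le> real m * \<bar>x $ j - y $ j\<bar>"
      using that by (intro mult_right_mono) auto
    ultimately show False by linarith
  qed
  then show ?thesis
    unfolding eventually_sequentially by blast
qed

lemma eventually_inj_on_cell:
  assumes "inj_on x {..n::nat}"
  shows "eventually (\<lambda>m. inj_on (\<lambda>k. cell m (x k)) {..n}) sequentially"
proof -
  have "eventually (\<lambda>m. \<forall>k\<in>{..n}. \<forall>l\<in>{..n} - {k}. cell m (x k) \<noteq> cell m (x l)) sequentially"
    using assms by (intro eventually_ball_finite ballI eventually_cell_neq) (auto simp: inj_on_def)
  then show ?thesis
    by eventually_elim (force simp: inj_on_def)
qed

context enumerated_poisson
begin

lemma inj_on_sample:
  assumes "snd p \<in> space M" "present n p" "inj_on (fst p) {..n}"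
  shows "inj_on (sample n p) {..n}"
proof (rule inj_onI)
  fix k l assume "k \<in> {..n}" "l \<in> {..n}" "sample n p k = sample n p l"
  then have "fst p k = fst p l"
    using assms(1,2) by (intro X_inj[of "snd p"]) (auto simp: sample_def present_def)
  then show "k = l"
    using assms(3) \<open>k \<in> {..n}\<close> \<open>l \<in> {..n}\<close> by (auto dest: inj_onD)
qed

text \<open>Such tuples are classified by the injective vector \<open>c\<close> of their cells. For
  fixed \<open>c\<close> the cells are disjoint and bounded, so the exact formula applies, and it is
  summed over the countably many \<open>c\<close>. The inequality arises only when distinctness of
  cells is dropped on the Lebesgue side.\<close>

lemma nn_integral_tuples_in_distinct_cells:
  assumes m: "0 < m" and f [measurable]: "f \<in> borel_measurable (\<Pi>\<^sub>M k\<in>{..n}. lborel)"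
  shows "(\<integral>\<^sup>+p. of_bool (present n p \<and> inj_on (\<lambda>k. cell m (sample n p k)) {..n}) * f (sample n p) \<partial>tuple_space n)
    \<le> ennreal lam ^ Suc n * (\<integral>\<^sup>+x. f x \<partial>(\<Pi>\<^sub>M k\<in>{..n}. lborel))"
proof -
  let ?P = "\<Pi>\<^sub>M k\<in>{..n}. lborel :: (real^2) measure"
  define I where "I = {c \<in> {..n} \<rightarrow>\<^sub>E (UNIV :: (int^2) set). inj_on c {..n}}"
  have I: "countable I"
    unfolding I_def by (rule countable_subset[OF _ countable_PiE[of "{..n}" "\<lambda>_. UNIV"]]) auto
  define Q where "Q c k = {x. cell m x = c k}" for c :: "nat \<Rightarrow> int^2" and k :: nat
  have Q: "Q c k \<in> sets borel" "bounded (Q c k)" for c k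
    unfolding Q_def using cell_vimage_bounded[OF m] by auto
  have [measurable]: "Pi\<^sub>E {..n} (Q c) \<in> sets ?P" for c
    using Q by (intro sets_PiM_I_finite) auto
  have disj: "disjoint_family_on (Q c) {..n}" if "c \<in> I" for c
    using that by (auto simp: disjoint_family_on_def Q_def I_def inj_on_def)
  have sum_indicator: "(\<integral>\<^sup>+c. indicator (Pi\<^sub>E {..n} (Q c)) x \<partial>count_space I) =
      of_bool (inj_on (\<lambda>k. cell m (x k)) {..n})"
    if x: "x \<in> extensional {..n}" for x
  proof -
    \<comment> \<open>Among the vectors in \<open>I\<close>, only the cell vector of
      \<open>x\<close> can have a box containing \<open>x\<close>; it belongs to \<open>I\<close>
      exactly if its entries are distinct.\<close>
    define c0 where "c0 = (\<lambda>k\<in>{..n}. cell m (x k))"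
    have c0: "x \<in> Pi\<^sub>E {..n} (Q c) \<longleftrightarrow> c = c0" if "c \<in> I" for c
      using x that unfolding PiE_iff Q_def I_def c0_def
      by (auto simp: fun_eq_iff extensional_def)
    have "(\<integral>\<^sup>+c. indicator (Pi\<^sub>E {..n} (Q c)) x \<partial>count_space I) =
        (\<integral>\<^sup>+c. indicator {c0} c \<partial>count_space I)"
      by (intro nn_integral_cong) (simp add: indicator_def c0)
    also have "\<dots> = (\<integral>\<^sup>+c. indicator ({c0} \<inter> I) c \<partial>count_space I)"
      by (intro nn_integral_cong) (simp add: indicator_def)
    also have "\<dots> = emeasure (count_space I) ({c0} \<inter> I)"
      by (rule nn_integral_indicator) simp
    also have "\<dots> = of_bool (c0 \<in> I)"
      by (auto simp: Int_insert_left)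
    also have "c0 \<in> I \<longleftrightarrow> inj_on (\<lambda>k. cell m (x k)) {..n}"
      unfolding I_def c0_def by (auto simp: inj_on_def)
    finally show ?thesis .
  qed
  have "(\<integral>\<^sup>+p. of_bool (present n p \<and> inj_on (\<lambda>k. cell m (sample n p k)) {..n}) * f (sample n p) \<partial>tuple_space n) =
      (\<integral>\<^sup>+p. (\<integral>\<^sup>+c. of_bool (present n p) * (indicator (Pi\<^sub>E {..n} (Q c)) (sample n p) * f (sample n p))
        \<partial>count_space I) \<partial>tuple_space n)"
  proof (intro nn_integral_cong)
    fix p
    have "sample n p \<in> extensional {..n}"
      by (simp add: sample_def)
    from sum_indicator[OF this] show "of_bool (present n p \<and> inj_on (\<lambda>k. cell m (sample n p k)) {..n}) * f (sample n p) =
      (\<integral>\<^sup>+c. of_bool (present n p) * (indicator (Pi\<^sub>E {..n} (Q c)) (sample n p) * f (sample n p)) \<partial>count_space I)"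
      by (simp add: nn_integral_cmult nn_integral_multc of_bool_conj mult.assoc)
  qed
  also have "\<dots> = (\<integral>\<^sup>+c. (\<integral>\<^sup>+p. of_bool (present n p) *
      (indicator (Pi\<^sub>E {..n} (Q c)) (sample n p) * f (sample n p)) \<partial>tuple_space n) \<partial>count_space I)"
    by (rule nn_integral_count_space_nn_integral[OF I]) measurable
  also have "\<dots> = (\<integral>\<^sup>+c. (\<integral>\<^sup>+x. ennreal lam ^ Suc n * (indicator (Pi\<^sub>E {..n} (Q c)) x * f x) \<partial>?P) \<partial>count_space I)"
    using Q disj by (intro nn_integral_cong nn_integral_tuples_in_disjoint_sets f) auto
  also have "\<dots> = (\<integral>\<^sup>+x. (\<integral>\<^sup>+c. ennreal lam ^ Suc n * (indicator (Pi\<^sub>E {..n} (Q c)) x * f x) \<partial>count_space I) \<partial>?P)"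
    by (rule nn_integral_count_space_nn_integral[OF I, symmetric]) measurable
  also have "\<dots> = (\<integral>\<^sup>+x. ennreal lam ^ Suc n * (of_bool (inj_on (\<lambda>k. cell m (x k)) {..n}) * f x) \<partial>?P)"
  proof (intro nn_integral_cong)
    fix x assume "x \<in> space ?P"
    then have "x \<in> extensional {..n}"
      by (simp add: space_PiM PiE_iff)
    from sum_indicator[OF this] show
      "(\<integral>\<^sup>+c. ennreal lam ^ Suc n * (indicator (Pi\<^sub>E {..n} (Q c)) x * f x) \<partial>count_space I) =
        ennreal lam ^ Suc n * (of_bool (inj_on (\<lambda>k. cell m (x k)) {..n}) * f x)"
      by (simp add: nn_integral_cmult nn_integral_multc)
  qed
  also have "\<dots> \<le> (\<integral>\<^sup>+x. ennreal lam ^ Suc n * f x \<partial>?P)"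
    by (intro nn_integral_mono mult_left_mono) auto
  also have "\<dots> = ennreal lam ^ Suc n * (\<integral>\<^sup>+x. f x \<partial>?P)"
    by (rule nn_integral_cmult) measurable
  finally show ?thesis .
qed

text \<open>Distinct points lie in distinct cells of every fine enough grid, so Fatou's lemma applies.\<close>

lemma factorial_moment_le:
  assumes f [measurable]: "f \<in> borel_measurable (\<Pi>\<^sub>M k\<in>{..n}. lborel)"
  shows "(\<integral>\<^sup>+p. of_bool (present n p \<and> inj_on (fst p) {..n}) * f (sample n p) \<partial>tuple_space n)
    \<le> ennreal lam ^ Suc n * (\<integral>\<^sup>+x. f x \<partial>(\<Pi>\<^sub>M k\<in>{..n}. lborel))"
proof -
  \<comment> \<open>\<open>Suc m\<close> avoids the degenerate grid with
    \<open>m = 0\<close>.\<close>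
  define u where "u m p = of_bool (present n p \<and> inj_on (\<lambda>k. cell (Suc m) (sample n p k)) {..n}) * f (sample n p)"
    for m p
  have [measurable]: "Measurable.pred (tuple_space n) (\<lambda>p. inj_on (\<lambda>k. cell m (sample n p k)) {..n})" for m
  proof -
    have "Measurable.pred (\<Pi>\<^sub>M k\<in>{..n}. lborel) (\<lambda>x. inj_on (\<lambda>k. cell m (x k)) {..n})"
    proof -
      have "(\<lambda>x. cell m (x k)) \<in> (\<Pi>\<^sub>M k\<in>{..n}. lborel) \<rightarrow>\<^sub>M count_space UNIV" if "k \<in> {..n}" for k
        using that by measurable
      \<comment> \<open>Labels are countable, so equality of two cells is tested by running through
        all values of one of them.\<close>
      then have "Measurable.pred (\<Pi>\<^sub>M k\<in>{..n}. lborel) (\<lambda>x. cell m (x k) = cell m (x l))"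
        if "k \<in> {..n}" "l \<in> {..n}" for k l
        using that
        by (intro measurable_compose_countable[where f = "\<lambda>c x. c = cell m (x l)" and g = "\<lambda>x. cell m (x k)"]) auto
      then show ?thesis
        unfolding inj_on_def by (intro pred_intros_finite pred_intros_logic) auto
    qed
    then show ?thesis
      by (rule measurable_compose[OF sample_measurable])
  qed
  have u [measurable]: "u m \<in> borel_measurable (tuple_space n)" for m
    unfolding u_def by measurable
  have "(\<integral>\<^sup>+p. of_bool (present n p \<and> inj_on (fst p) {..n}) * f (sample n p) \<partial>tuple_space n)
      \<le> (\<integral>\<^sup>+p. liminf (\<lambda>m. u m p) \<partial>tuple_space n)"
  \<comment> \<open>If the tuple is present with distinct indices, the approximants eventually equal
    the integrand; otherwise the integrand is 0.\<close>
  proof (intro nn_integral_mono Liminf_bounded)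
    fix p assume p: "p \<in> space (tuple_space n)"
    show "\<forall>\<^sub>F m in sequentially. of_bool (present n p \<and> inj_on (fst p) {..n}) * f (sample n p) \<le> u m p"
    proof (cases "present n p \<and> inj_on (fst p) {..n}")
      case True
      then have "inj_on (sample n p) {..n}"
        using p by (intro inj_on_sample) (auto simp: space_tuple_space)
      then have "\<forall>\<^sub>F m in sequentially. inj_on (\<lambda>k. cell m (sample n p k)) {..n}"
        by (rule eventually_inj_on_cell)
      then have "\<forall>\<^sub>F m in sequentially. inj_on (\<lambda>k. cell (Suc m) (sample n p k)) {..n}"
        by (subst eventually_sequentially_Suc)
      then show ?thesis
        by eventually_elim (use True in \<open>simp add: u_def\<close>)
    qed auto
  qed
  also have "\<dots> \<le> liminf (\<lambda>m. \<integral>\<^sup>+p. u m p \<partial>tuple_space n)"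
    by (rule nn_integral_liminf) (rule u)
  also have "\<dots> \<le> ennreal lam ^ Suc n * (\<integral>\<^sup>+x. f x \<partial>(\<Pi>\<^sub>M k\<in>{..n}. lborel))"
    unfolding u_def
    by (intro Liminf_le always_eventually allI nn_integral_tuples_in_distinct_cells f) auto
  finally show ?thesis .
qed

end

section \<open>Lebesgue integral of a chain weight\<close>

text \<open>Integrating out the last point gives the integral of \<open>h 0\<close>, wherever its
  predecessor lies. Induction removes all points but the first, which contributes the measure of
  \<open>B\<close>.\<close>

lemma nn_integral_chain_weight:
  fixes h :: "real^2 \<Rightarrow> real^2 \<Rightarrow> real"
  assumes h [measurable]: "(\<lambda>(x, y). h x y) \<in> borel_measurable (borel \<Otimes>\<^sub>M borel)"
    and trans: "\<And>x y. h x y = h 0 (y - x)"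
    and B [measurable]: "B \<in> sets borel"
  shows "(\<integral>\<^sup>+x. indicator B (x 0) * (\<Prod>k<n. ennreal (h (x k) (x (Suc k)))) \<partial>(\<Pi>\<^sub>M k\<in>{..n}. lborel)) =
    emeasure lborel B * (\<integral>\<^sup>+y. ennreal (h 0 y) \<partial>lborel) ^ n"
proof (induction n)
  interpret P: product_sigma_finite "\<lambda>_::nat. lborel :: (real^2) measure"
    by (rule sigma_finite_lborel_product)
  {
    case 0
    have "(\<integral>\<^sup>+x. indicator B (x 0) \<partial>(\<Pi>\<^sub>M k\<in>{0::nat}. lborel)) = (\<integral>\<^sup>+x. indicator B x \<partial>lborel)"
      by (rule P.product_nn_integral_singleton) simp
    then show ?case by (simp add: atMost_0)
  next
    case (Suc n)
    let ?P = "\<lambda>n. \<Pi>\<^sub>M k\<in>{..n}. lborel :: (real^2) measure"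
    let ?H = "\<integral>\<^sup>+y. ennreal (h 0 y) \<partial>lborel"
    define w where "w n x = indicator B (x 0) * (\<Prod>k<n. ennreal (h (x k) (x (Suc k))))"
      for n and x :: "nat \<Rightarrow> real^2"
    have h2 [measurable]: "(\<lambda>p. h (a p) (b p)) \<in> borel_measurable S"
      if "a \<in> S \<rightarrow>\<^sub>M borel" "b \<in> S \<rightarrow>\<^sub>M borel" for a b :: "'z \<Rightarrow> real^2" and S
      using measurable_compose[OF measurable_Pair[OF that] h] by simp
    have [measurable]: "w n \<in> borel_measurable (?P n)" for n
      unfolding w_def by (intro borel_measurable_times_ennreal borel_measurable_prod_ennreal) auto
    \<comment> \<open>The shift by \<open>z\<close> preserves Lebesgue measure and turns
      \<open>h z\<close> into \<open>h 0\<close>.\<close>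
    have H: "(\<integral>\<^sup>+y. ennreal (h z y) \<partial>lborel) = ?H" for z
    proof -
      have "?H = (\<integral>\<^sup>+y. ennreal (h z y) \<partial>distr lborel borel ((+) z))"
        by (subst nn_integral_distr) (auto simp: trans[of z])
      then show ?thesis by (simp add: lborel_distr_plus)
    qed
    have "(\<integral>\<^sup>+x. w (Suc n) x \<partial>?P (Suc n)) = (\<integral>\<^sup>+x. \<integral>\<^sup>+y. w (Suc n) (x(Suc n := y)) \<partial>lborel \<partial>?P n)"
      unfolding atMost_Suc by (rule P.product_nn_integral_insert) (auto simp flip: atMost_Suc)
    also have "\<dots> = (\<integral>\<^sup>+x. \<integral>\<^sup>+y. w n x * ennreal (h (x n) y) \<partial>lborel \<partial>?P n)"
      by (intro nn_integral_cong) (auto simp: w_def mult.assoc intro!: arg_cong2[where f = "(*)"] prod.cong)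
    also have "\<dots> = (\<integral>\<^sup>+x. w n x * ?H \<partial>?P n)"
      by (intro nn_integral_cong) (subst nn_integral_cmult, simp, subst H, rule refl)
    also have "\<dots> = (\<integral>\<^sup>+x. w n x \<partial>?P n) * ?H"
      by (rule nn_integral_multc) measurable
    finally show ?case
      using Suc.IH unfolding w_def by (simp add: mult_ac)
  }
qed

section \<open>Chains of marked points\<close>

text \<open>Edge variables are indexed by pairs \<open>i < j\<close>, while a chain may visit the
  indices in any order; hence the sorted pair.\<close>

definition step :: "(nat \<Rightarrow> nat) \<Rightarrow> nat \<Rightarrow> nat \<times> nat" where
  "step i k = (min (i k) (i (Suc k)), max (i k) (i (Suc k)))"

text \<open>Equal sorted pairs agree either directly or crosswise. The crosswise case would need
  \<open>k = Suc l\<close> and \<open>Suc k = l\<close>. Distinct steps thus use distinct edge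
  variables, as the product rule requires.\<close>

lemma inj_on_step:
  assumes "inj_on i {..n}"
  shows "inj_on (step i) {..<n}"
proof (rule inj_onI)
  fix k l assume kl: "k \<in> {..<n}" "l \<in> {..<n}" "step i k = step i l"
  then have "i k = i l \<and> i (Suc k) = i (Suc l) \<or> i k = i (Suc l) \<and> i (Suc k) = i l"
    by (auto simp: step_def min_def max_def split: if_splits)
  moreover have "i a = i b \<longleftrightarrow> a = b" if "a \<le> n" "b \<le> n" for a b
    using inj_on_eq_iff[OF assms] that by auto
  ultimately show "k = l"
    using kl by auto
qed

locale marked_poisson = enumerated_poisson M lam \<Phi> N X
  for M :: "'w measure" and lam :: real and \<Phi> :: "'w \<Rightarrow> (real^2) set"
    and N :: "'w \<Rightarrow> enat" and X :: "nat \<Rightarrow> 'w \<Rightarrow> real^2" +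
  fixes t :: "'w \<Rightarrow> real^2 \<Rightarrow> real"
    and C :: "'w \<Rightarrow> real^2 \<Rightarrow> real^2 \<Rightarrow> bool"
    and h :: "real^2 \<Rightarrow> real^2 \<Rightarrow> real"
  assumes timers: "iid_uniform_timers M N X t"
    and edges: "cond_indep_edges M \<Phi> N X t C h"
    and h_measurable: "(\<lambda>(x, y). h x y) \<in> borel_measurable (borel \<Otimes>\<^sub>M borel)"
    and h_range: "\<And>x y. h x y \<in> {0..1}"
    and h_symmetric: "\<And>x y. h x y = h y x"
    and h_translation: "\<And>x y. h x y = h 0 (y - x)"
begin

text \<open>For distinct points starting in \<open>B\<close>, this is the conditional probability,
  given the points, that all \<open>n\<close> steps are edges.\<close>

definition chain_weight :: "nat \<Rightarrow> (real^2) set \<Rightarrow> (nat \<Rightarrow> real^2) \<Rightarrow> ennreal" where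
  "chain_weight n B x = indicator B (x 0) * (\<Prod>k<n. ennreal (h (x k) (x (Suc k))))"

text \<open>The order of the timers is not recorded, only that all lie in \<open>D\<close>; this
  suffices for an upper bound and makes the timer law a plain power. Tuples with repeated indices
  give the empty event.\<close>

definition chain_event :: "nat \<Rightarrow> (real^2) set \<Rightarrow> real set \<Rightarrow> (nat \<Rightarrow> nat) \<Rightarrow> 'w set" where
  "chain_event n B D i = {\<omega> \<in> space M. inj_on i {..n} \<and> present n (i, \<omega>) \<and> X (i 0) \<omega> \<in> B \<and>
     (\<forall>k\<le>n. timer_seq N X t (i k) \<omega> \<in> D) \<and>
     (\<forall>k<n. \<omega> \<in> edge_event M N X C (fst (step i k)) (snd (step i k)))}"

lemma h_measurable2 [measurable (raw)]:
  assumes "a \<in> S \<rightarrow>\<^sub>M borel" "b \<in> S \<rightarrow>\<^sub>M borel"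
  shows "(\<lambda>p. h (a p) (b p)) \<in> borel_measurable S"
  using measurable_compose[OF measurable_Pair[OF assms] h_measurable] by simp

lemma timer_measurable [measurable]: "timer_seq N X t n \<in> borel_measurable M"
  using timers by (simp add: iid_uniform_timers_def)

lemma points_algebra_measurable:
  "N \<in> points_algebra M N X \<rightarrow>\<^sub>M count_space UNIV" "X n \<in> points_algebra M N X \<rightarrow>\<^sub>M borel"
proof -
  have g: "(\<lambda>\<omega>. (N \<omega>, \<lambda>n. X n \<omega>)) \<in> points_algebra M N X \<rightarrow>\<^sub>M count_space UNIV \<Otimes>\<^sub>M (\<Pi>\<^sub>M n\<in>UNIV. borel)"
    unfolding points_algebra_def
    by (rule measurable_vimage_algebra1) (simp add: space_pair_measure space_PiM)
  show "N \<in> points_algebra M N X \<rightarrow>\<^sub>M count_space UNIV"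
    using measurable_compose[OF g measurable_fst] by simp
  show "X n \<in> points_algebra M N X \<rightarrow>\<^sub>M borel"
    using measurable_compose[OF measurable_compose[OF g measurable_snd] measurable_component_singleton[of n]]
    by simp
qed

lemma points_timers_algebra_measurable:
  "N \<in> points_timers_algebra M N X t \<rightarrow>\<^sub>M count_space UNIV"
  "X n \<in> points_timers_algebra M N X t \<rightarrow>\<^sub>M borel"
  "timer_seq N X t n \<in> points_timers_algebra M N X t \<rightarrow>\<^sub>M borel"
proof -
  have g: "(\<lambda>\<omega>. (N \<omega>, \<lambda>n. X n \<omega>, \<lambda>n. timer_seq N X t n \<omega>)) \<in> points_timers_algebra M N X t
      \<rightarrow>\<^sub>M count_space UNIV \<Otimes>\<^sub>M (\<Pi>\<^sub>M n\<in>UNIV. borel) \<Otimes>\<^sub>M (\<Pi>\<^sub>M n\<in>UNIV. borel)"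
    unfolding points_timers_algebra_def
    by (rule measurable_vimage_algebra1) (simp add: space_pair_measure space_PiM)
  note g' = measurable_compose[OF g measurable_snd]
  show "N \<in> points_timers_algebra M N X t \<rightarrow>\<^sub>M count_space UNIV"
    using measurable_compose[OF g measurable_fst] by simp
  show "X n \<in> points_timers_algebra M N X t \<rightarrow>\<^sub>M borel"
    using measurable_compose[OF measurable_compose[OF g' measurable_fst] measurable_component_singleton[of n]]
    by simp
  show "timer_seq N X t n \<in> points_timers_algebra M N X t \<rightarrow>\<^sub>M borel"
    using measurable_compose[OF measurable_compose[OF g' measurable_snd] measurable_component_singleton[of n]]
    by simp
qed

sublocale points: finite_measure_subalgebra M "points_algebra M N X"
  by unfold_locales (rule subalgebra_points_algebra[OF enumeration])

sublocale points_timers: finite_measure_subalgebra M "points_timers_algebra M N X t"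
  by unfold_locales (rule subalgebra_points_timers_algebra[OF enumeration timers])

lemma edge_event_measurable: "i < j \<Longrightarrow> edge_event M N X C i j \<in> sets M"
  using edges by (simp add: cond_indep_edges_def)

lemma step_event_measurable:
  assumes "inj_on i {..n}" "k < n"
  shows "edge_event M N X C (fst (step i k)) (snd (step i k)) \<in> sets M"
proof (rule edge_event_measurable)
  have "i k \<noteq> i (Suc k)"
    using assms by (auto simp: inj_on_eq_iff)
  then show "fst (step i k) < snd (step i k)"
    by (simp add: step_def min_def max_def)
qed

lemma chain_event_measurable [measurable]:
  assumes "B \<in> sets borel" "D \<in> sets borel"
  shows "chain_event n B D i \<in> sets M"
proof (cases "inj_on i {..n}")
  case True
  have [measurable]: "Measurable.pred M (\<lambda>\<omega>. \<omega> \<in> edge_event M N X C (fst (step i k)) (snd (step i k)))" if "k < n" for k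
    using step_event_measurable[OF True that] by measurable
  have [measurable]: "B \<in> sets borel" "D \<in> sets borel" by fact+
  show ?thesis
    unfolding chain_event_def present_def using True by simp
qed (simp add: chain_event_def)

section \<open>Conditional laws along a fixed index tuple\<close>

text \<open>The laws of the marks are given on events of the form
  \<open>enat k \<le> N \<omega>\<close>; for a tuple the right \<open>k\<close> is one more than
  its largest index.\<close>

lemma present_iff:
  "present n (i, \<omega>) \<longleftrightarrow> enat (Suc (Max (i ` {..n}))) \<le> N \<omega>"
proof -
  have "present n (i, \<omega>) \<longleftrightarrow> (\<forall>j\<in>i ` {..n}. enat j < N \<omega>)"
    by (auto simp: present_def)
  also have "\<dots> \<longleftrightarrow> enat (Max (i ` {..n})) < N \<omega>"
  proof
    assume "\<forall>j\<in>i ` {..n}. enat j < N \<omega>"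
    moreover have "Max (i ` {..n}) \<in> i ` {..n}"
      by (rule Max_in) auto
    ultimately show "enat (Max (i ` {..n})) < N \<omega>" ..
  next
    assume "enat (Max (i ` {..n})) < N \<omega>"
    moreover have "enat j \<le> enat (Max (i ` {..n}))" if "j \<in> i ` {..n}" for j
      using that by simp
    ultimately show "\<forall>j\<in>i ` {..n}. enat j < N \<omega>"
      using le_less_trans by blast
  qed
  finally show ?thesis by (simp add: Suc_ile_eq)
qed

text \<open>The edge law is applied to the set of sorted pairs of the chain. Injectivity of
  \<open>step i\<close> yields one factor per step, and symmetry of \<open>h\<close> undoes the
  sorting.\<close>

lemma real_cond_exp_steps:
  assumes inj: "inj_on i {..n}"
  shows "AE \<omega> in M. present n (i, \<omega>) \<longrightarrow>
    real_cond_exp M (points_timers_algebra M N X t)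
      (indicator {\<omega> \<in> space M. \<forall>k<n. \<omega> \<in> edge_event M N X C (fst (step i k)) (snd (step i k))}) \<omega> =
    (\<Prod>k<n. h (X (i k) \<omega>) (X (i (Suc k)) \<omega>))"
proof -
  let ?K = "Suc (Max (i ` {..n}))" and ?S = "step i ` {..<n}"
  have "?S \<subseteq> {(a, b). a < b \<and> b < ?K}"
  proof
    fix s assume "s \<in> ?S"
    then obtain k where k: "k < n" "s = step i k" by auto
    have "i k \<noteq> i (Suc k)"
      using inj k(1) by (auto simp: inj_on_eq_iff)
    moreover have "i k \<le> Max (i ` {..n})" "i (Suc k) \<le> Max (i ` {..n})"
      using k(1) by auto
    ultimately show "s \<in> {(a, b). a < b \<and> b < ?K}"
      by (auto simp: k step_def min_def max_def)
  qed
  then have "AE \<omega> in M. enat ?K \<le> N \<omega> \<longrightarrow>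
      real_cond_exp M (points_timers_algebra M N X t)
        (indicator {\<omega> \<in> space M. \<forall>(a, b)\<in>?S. \<omega> \<in> edge_event M N X C a b}) \<omega> =
      (\<Prod>(a, b)\<in>?S. h (X a \<omega>) (X b \<omega>))"
    using edges unfolding cond_indep_edges_def by blast
  moreover have "(\<Prod>(a, b)\<in>?S. h (X a \<omega>) (X b \<omega>)) = (\<Prod>k<n. h (X (i k) \<omega>) (X (i (Suc k)) \<omega>))" for \<omega>
    using h_symmetric
    by (subst prod.reindex[OF inj_on_step[OF inj]]) (auto intro!: prod.cong simp: step_def min_def max_def)
  moreover have "(\<forall>(a, b)\<in>?S. \<omega> \<in> edge_event M N X C a b) \<longleftrightarrow>
      (\<forall>k<n. \<omega> \<in> edge_event M N X C (fst (step i k)) (snd (step i k)))" for \<omega>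
    by (auto simp: case_prod_beta)
  ultimately show ?thesis
    by (simp add: present_iff)
qed

lemma real_cond_exp_timers:
  assumes inj: "inj_on i {..n}" and D: "D \<in> sets borel"
  shows "AE \<omega> in M. present n (i, \<omega>) \<longrightarrow>
    real_cond_exp M (points_algebra M N X)
      (indicator {\<omega> \<in> space M. \<forall>k\<le>n. timer_seq N X t (i k) \<omega> \<in> D}) \<omega> =
    measure (uniform_measure lborel {0..1}) D ^ Suc n"
proof -
  let ?K = "Suc (Max (i ` {..n}))" and ?U = "uniform_measure lborel {0..1::real}"
  \<comment> \<open>The law concerns an initial segment of timers; indices outside the tuple get the
    whole line and so contribute the factor 1.\<close>
  define D' where "D' j = (if j \<in> i ` {..n} then D else UNIV)" for j
  have K: "i k < ?K" if "k \<le> n" for k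
    using that by (simp add: less_Suc_eq_le)
  have "\<forall>j<?K. D' j \<in> sets borel"
    using D by (simp add: D'_def)
  then have "AE \<omega> in M. enat ?K \<le> N \<omega> \<longrightarrow>
      real_cond_exp M (points_algebra M N X)
        (indicator {\<omega> \<in> space M. \<forall>j<?K. timer_seq N X t j \<omega> \<in> D' j}) \<omega> = (\<Prod>j<?K. measure ?U (D' j))"
    using timers unfolding iid_uniform_timers_def by blast
  moreover have "(\<Prod>j<?K. measure ?U (D' j)) = measure ?U D ^ Suc n"
  proof -
    have "(\<Prod>j<?K. measure ?U (D' j)) = (\<Prod>j<?K. if j \<in> i ` {..n} then measure ?U D else 1)"
      by (intro prod.cong refl) (simp add: D'_def measure_uniform_measure)
    also have "\<dots> = measure ?U D ^ card ({..<?K} \<inter> i ` {..n})"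
      by (simp only: prod.If_cases[OF finite_lessThan] Collect_mem_eq prod_constant power_one mult_1_right)
    also have "{..<?K} \<inter> i ` {..n} = i ` {..n}"
      using K by auto
    finally show ?thesis
      by (simp only: card_image[OF inj] card_atMost)
  qed
  moreover have "(\<forall>j<?K. timer_seq N X t j \<omega> \<in> D' j) \<longleftrightarrow> (\<forall>k\<le>n. timer_seq N X t (i k) \<omega> \<in> D)" for \<omega>
    using K by (auto simp: D'_def)
  ultimately show ?thesis
    by (simp add: present_iff)
qed

text \<open>Two successive conditionings: given points and timers, the edges contribute
  \<open>V\<close>; given the points alone, the timers contribute the constant
  \<open>?p ^ Suc n\<close>. Each time the other factors are measurable for the conditioning algebra
  and can be pulled out.\<close>

lemma emeasure_chain_event:
  assumes inj: "inj_on i {..n}" and B [measurable]: "B \<in> sets borel" and D [measurable]: "D \<in> sets borel"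
  shows "emeasure M (chain_event n B D i) = ennreal (measure (uniform_measure lborel {0..1}) D) ^ Suc n *
    (\<integral>\<^sup>+\<omega>. of_bool (present n (i, \<omega>)) * chain_weight n B (sample n (i, \<omega>)) \<partial>M)"
proof -
  let ?F1 = "points_algebra M N X" and ?F2 = "points_timers_algebra M N X t"
  let ?p = "measure (uniform_measure lborel {0..1}) D"
  define T where "T = {\<omega> \<in> space M. \<forall>k\<le>n. timer_seq N X t (i k) \<omega> \<in> D}"
  define E where "E = {\<omega> \<in> space M. \<forall>k<n. \<omega> \<in> edge_event M N X C (fst (step i k)) (snd (step i k))}"
  define W :: "'w \<Rightarrow> real" where "W \<omega> = of_bool (present n (i, \<omega>) \<and> X (i 0) \<omega> \<in> B)" for \<omega>
  define V where "V \<omega> = (\<Prod>k<n. h (X (i k) \<omega>) (X (i (Suc k)) \<omega>))" for \<omega>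
  have T [measurable]: "T \<in> sets M"
    unfolding T_def by measurable
  have E [measurable]: "E \<in> sets M"
  proof -
    have [measurable]: "Measurable.pred M (\<lambda>\<omega>. \<omega> \<in> edge_event M N X C (fst (step i k)) (snd (step i k)))" if "k < n" for k
      using step_event_measurable[OF inj that] by measurable
    show ?thesis unfolding E_def by simp
  qed
  have W1: "W \<in> borel_measurable ?F1" and V1: "V \<in> borel_measurable ?F1"
    unfolding W_def V_def present_def using points_algebra_measurable by simp_all
  have W2: "(\<lambda>\<omega>. W \<omega> * indicator T \<omega>) \<in> borel_measurable ?F2"
  proof -
    note [measurable] = points_timers_algebra_measurable
    have "(\<lambda>\<omega>. W \<omega> * of_bool (\<forall>k\<le>n. timer_seq N X t (i k) \<omega> \<in> D)) \<in> borel_measurable ?F2"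
      unfolding W_def present_def by simp
    also have "?this \<longleftrightarrow> ?thesis"
      using points_timers.subalg
      by (intro measurable_cong) (auto simp: T_def indicator_def subalgebra_def)
    finally show ?thesis .
  qed
  have [measurable]: "W \<in> borel_measurable M" "V \<in> borel_measurable M"
    using W1 V1 points.subalg by (blast intro: measurable_from_subalg)+
  have W: "0 \<le> W \<omega>" "W \<omega> \<le> 1" for \<omega>
    by (auto simp: W_def)
  have V: "0 \<le> V \<omega>" "V \<omega> \<le> 1" for \<omega>
    using h_range by (auto simp: V_def intro!: prod_nonneg prod_le_1)
  have WV: "W \<omega> * V \<omega> \<le> 1" for \<omega>
    using W V by (intro mult_le_one)
  have int: "integrable M (\<lambda>\<omega>. W \<omega> * indicator T \<omega> * indicator E \<omega>)"
    "integrable M (\<lambda>\<omega>. W \<omega> * V \<omega> * indicator T \<omega>)" "integrable M (\<lambda>\<omega>. W \<omega> * V \<omega>)"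
    using W V WV
    by (auto intro!: integrable_const_bound[where B = 1] simp: abs_mult indicator_def)
  have "measure M (chain_event n B D i) = (\<integral>\<omega>. W \<omega> * indicator T \<omega> * indicator E \<omega> \<partial>M)"
  proof -
    have "measure M (chain_event n B D i) = (\<integral>\<omega>. indicator (chain_event n B D i) \<omega> \<partial>M)"
      by simp
    also have "\<dots> = (\<integral>\<omega>. W \<omega> * indicator T \<omega> * indicator E \<omega> \<partial>M)"
      using inj
      by (intro Bochner_Integration.integral_cong) (auto simp: chain_event_def W_def T_def E_def indicator_def)
    finally show ?thesis .
  qed
  also have "\<dots> = (\<integral>\<omega>. W \<omega> * indicator T \<omega> * real_cond_exp M ?F2 (indicator E) \<omega> \<partial>M)"
    by (rule points_timers.real_cond_exp_intg(2)[symmetric]) (use int(1) W2 in auto)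
  \<comment> \<open>The conditional law is known only where the tuple is present; elsewhere
    \<open>W\<close> vanishes.\<close>
  also have "\<dots> = (\<integral>\<omega>. W \<omega> * V \<omega> * indicator T \<omega> \<partial>M)"
  proof (rule integral_cong_AE)
    show "AE \<omega> in M. W \<omega> * indicator T \<omega> * real_cond_exp M ?F2 (indicator E) \<omega> = W \<omega> * V \<omega> * indicator T \<omega>"
      using real_cond_exp_steps[OF inj, folded E_def]
      by eventually_elim (auto simp: W_def V_def)
  qed measurable
  also have "\<dots> = (\<integral>\<omega>. W \<omega> * V \<omega> * real_cond_exp M ?F1 (indicator T) \<omega> \<partial>M)"
    by (rule points.real_cond_exp_intg(2)[symmetric]) (use int(2) W1 V1 in auto)
  also have "\<dots> = (\<integral>\<omega>. W \<omega> * V \<omega> * ?p ^ Suc n \<partial>M)"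
  proof (rule integral_cong_AE)
    show "AE \<omega> in M. W \<omega> * V \<omega> * real_cond_exp M ?F1 (indicator T) \<omega> = W \<omega> * V \<omega> * ?p ^ Suc n"
      using real_cond_exp_timers[OF inj D, folded T_def]
      by eventually_elim (auto simp: W_def)
  qed measurable
  also have "\<dots> = ?p ^ Suc n * (\<integral>\<omega>. W \<omega> * V \<omega> \<partial>M)"
    by simp
  finally have "emeasure M (chain_event n B D i) = ennreal ?p ^ Suc n * ennreal (\<integral>\<omega>. W \<omega> * V \<omega> \<partial>M)"
    using W V by (simp add: emeasure_eq_measure ennreal_mult ennreal_power integral_nonneg)
  also have "ennreal (\<integral>\<omega>. W \<omega> * V \<omega> \<partial>M) = (\<integral>\<^sup>+\<omega>. ennreal (W \<omega> * V \<omega>) \<partial>M)"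
    using W V int(3) by (intro nn_integral_eq_integral[symmetric]) auto
  also have "\<dots> = (\<integral>\<^sup>+\<omega>. of_bool (present n (i, \<omega>)) * chain_weight n B (sample n (i, \<omega>)) \<partial>M)"
  proof (intro nn_integral_cong)
    fix \<omega>
    have "chain_weight n B (sample n (i, \<omega>)) = indicator B (X (i 0) \<omega>) * ennreal (V \<omega>)"
      using h_range by (auto simp: chain_weight_def sample_def V_def prod_ennreal)
    then show "ennreal (W \<omega> * V \<omega>) = of_bool (present n (i, \<omega>)) * chain_weight n B (sample n (i, \<omega>))"
      by (auto simp: W_def indicator_def)
  qed
  finally show ?thesis .
qed

section \<open>First-moment bound and well-foundedness\<close>

text \<open>The probability that some chain exists is at most the expected number of chains, which
  the factorial moment bound reduces to the Lebesgue integral of the chain weight.\<close>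

lemma emeasure_UN_chain_event:
  assumes B [measurable]: "B \<in> sets borel" and D [measurable]: "D \<in> sets borel"
  shows "emeasure M (\<Union>i\<in>{..n} \<rightarrow>\<^sub>E UNIV. chain_event n B D i) \<le>
    ennreal (measure (uniform_measure lborel {0..1}) D) ^ Suc n *
    (ennreal lam ^ Suc n * (emeasure lborel B * (\<integral>\<^sup>+y. ennreal (h 0 y) \<partial>lborel) ^ n))"
proof -
  let ?I = "{..n} \<rightarrow>\<^sub>E (UNIV :: nat set)" and ?p = "measure (uniform_measure lborel {0..1}) D"
  let ?g = "\<lambda>p. of_bool (present n p \<and> inj_on (fst p) {..n}) * chain_weight n B (sample n p)"
  have w [measurable]: "chain_weight n B \<in> borel_measurable (\<Pi>\<^sub>M k\<in>{..n}. lborel)"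
    unfolding chain_weight_def by measurable
  have [measurable]: "Measurable.pred (tuple_space n) (\<lambda>p. inj_on (fst p) {..n})"
    unfolding tuple_space_def by (rule measurable_compose[OF measurable_fst]) simp
  have "emeasure M (\<Union>i\<in>?I. chain_event n B D i) =
      (\<integral>\<^sup>+\<omega>. indicator (\<Union>i\<in>?I. chain_event n B D i) \<omega> \<partial>M)"
    using countable_tuples by (intro nn_integral_indicator[symmetric] sets.countable_UN'') auto
  also have "\<dots> \<le> (\<integral>\<^sup>+\<omega>. \<integral>\<^sup>+i. indicator (chain_event n B D i) \<omega> \<partial>count_space ?I \<partial>M)"
  proof (intro nn_integral_mono)
    fix \<omega>
    show "indicator (\<Union>i\<in>?I. chain_event n B D i) \<omega> \<le>
        (\<integral>\<^sup>+i. indicator (chain_event n B D i) \<omega> \<partial>count_space ?I)"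
    proof (cases "\<omega> \<in> (\<Union>i\<in>?I. chain_event n B D i)")
      case True
      then obtain i where i: "i \<in> ?I" "\<omega> \<in> chain_event n B D i" by auto
      then show ?thesis
        using nn_integral_ge_point[OF i(1), of "\<lambda>i. indicator (chain_event n B D i) \<omega>"] True by simp
    qed simp
  qed
  also have "\<dots> = (\<integral>\<^sup>+i. emeasure M (chain_event n B D i) \<partial>count_space ?I)"
    by (subst nn_integral_count_space_nn_integral[OF countable_tuples]) auto
  also have "\<dots> = (\<integral>\<^sup>+i. ennreal ?p ^ Suc n * (\<integral>\<^sup>+\<omega>. ?g (i, \<omega>) \<partial>M) \<partial>count_space ?I)"
  proof (intro nn_integral_cong)
    fix i
    show "emeasure M (chain_event n B D i) = ennreal ?p ^ Suc n * (\<integral>\<^sup>+\<omega>. ?g (i, \<omega>) \<partial>M)"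
      \<comment> \<open>For a tuple with repeated indices both sides are 0.\<close>
      by (cases "inj_on i {..n}") (simp_all add: emeasure_chain_event, simp add: chain_event_def)
  qed
  also have "\<dots> = ennreal ?p ^ Suc n * (\<integral>\<^sup>+p. ?g p \<partial>tuple_space n)"
    by (subst nn_integral_tuple_space) (auto simp: nn_integral_cmult)
  also have "\<dots> \<le> ennreal ?p ^ Suc n *
      (ennreal lam ^ Suc n * (\<integral>\<^sup>+x. chain_weight n B x \<partial>(\<Pi>\<^sub>M k\<in>{..n}. lborel)))"
    by (intro mult_left_mono factorial_moment_le w) simp
  also have "(\<integral>\<^sup>+x. chain_weight n B x \<partial>(\<Pi>\<^sub>M k\<in>{..n}. lborel)) =
      emeasure lborel B * (\<integral>\<^sup>+y. ennreal (h 0 y) \<partial>lborel) ^ n"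
    unfolding chain_weight_def by (rule nn_integral_chain_weight[OF h_measurable h_translation B])
  finally show ?thesis .
qed

text \<open>The event that chains of every length exist lies in each \<open>U n\<close>, so its
  probability is below every term of a geometric sequence with ratio
  \<open>lam * ?p * H < 1\<close>.\<close>

lemma AE_no_infinite_chain:
  assumes B: "B \<in> sets borel" "bounded B" and D: "D \<in> sets borel"
    and H: "(\<integral>\<^sup>+y. ennreal (h 0 y) \<partial>lborel) = ennreal H" "0 \<le> H"
    and small: "lam * measure (uniform_measure lborel {0..1}) D * H < 1"
  shows "AE \<omega> in M. \<exists>n. \<forall>i\<in>{..n} \<rightarrow>\<^sub>E UNIV. \<omega> \<notin> chain_event n B D i"
proof -
  let ?p = "measure (uniform_measure lborel {0..1}) D"
  define U where "U n = (\<Union>i\<in>{..n} \<rightarrow>\<^sub>E UNIV. chain_event n B D i)" for n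
  have U: "U n \<in> sets M" for n
    unfolding U_def using B D countable_tuples by (intro sets.countable_UN'') auto
  obtain b where b: "emeasure lborel B = ennreal b" "0 \<le> b"
    using emeasure_bounded_finite[OF B(2)] by (cases "emeasure lborel B") auto
  have bound: "emeasure M (\<Inter>n. U n) \<le> ennreal (?p * lam * b * (lam * ?p * H) ^ n)" for n
  proof -
    have "emeasure M (\<Inter>n. U n) \<le> emeasure M (U n)"
      using U by (intro emeasure_mono) auto
    also have "\<dots> \<le> ennreal ?p ^ Suc n * (ennreal lam ^ Suc n * (ennreal b * ennreal H ^ n))"
      unfolding U_def b(1)[symmetric] H(1)[symmetric] by (rule emeasure_UN_chain_event[OF B(1) D])
    also have "\<dots> = ennreal (?p ^ Suc n * (lam ^ Suc n * (b * H ^ n)))"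
      using b H lam_nonneg by (simp add: ennreal_power flip: ennreal_mult)
    also have "?p ^ Suc n * (lam ^ Suc n * (b * H ^ n)) = ?p * lam * b * (lam * ?p * H) ^ n"
      by (simp add: power_mult_distrib)
    finally show ?thesis .
  qed
  have "(\<lambda>n. ennreal (?p * lam * b * (lam * ?p * H) ^ n)) \<longlonglongrightarrow> ennreal (?p * lam * b * 0)"
    using small H(2) lam_nonneg
    by (intro tendsto_ennrealI tendsto_mult tendsto_const LIMSEQ_realpow_zero) auto
  then have "emeasure M (\<Inter>n. U n) \<le> ennreal (?p * lam * b * 0)"
    by (rule LIMSEQ_le_const) (use bound in blast)
  then have "(\<Inter>n. U n) \<in> null_sets M"
    using U by (intro null_setsI) auto
  then have "AE \<omega> in M. \<omega> \<notin> (\<Inter>n. U n)"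
    by (rule AE_not_in)
  then show ?thesis
    by (rule AE_mp) (auto simp: U_def intro!: AE_I2)
qed

text \<open>Strictly decreasing timers make the points of the chain distinct, hence also their
  indices, and the first \<open>n + 1\<close> indices form the tuple. Symmetry of \<open>C\<close>
  matches the steps with the sorted edge variables.\<close>

lemma chain_in_chain_event:
  assumes \<omega>: "\<omega> \<in> space M" and f: "\<And>k. f k \<in> \<Phi> \<omega>" "\<And>k. t \<omega> (f (Suc k)) < t \<omega> (f k)"
      "\<And>k. C \<omega> (f k) (f (Suc k))" "\<And>k. t \<omega> (f k) \<in> D" "f 0 \<in> B"
  shows "\<exists>i\<in>{..n} \<rightarrow>\<^sub>E UNIV. \<omega> \<in> chain_event n B D i"
proof -
  have "\<forall>k. \<exists>j. enat j < N \<omega> \<and> X j \<omega> = f k"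
    using X_surj[OF \<omega> f(1)] by metis
  then obtain j where j: "\<And>k. enat (j k) < N \<omega>" "\<And>k. X (j k) \<omega> = f k"
    by metis
  have "t \<omega> (f l) < t \<omega> (f k)" if "k < l" for k l
    \<comment> \<open>The monotonicity rule is for increasing sequences, hence the sign
      change.\<close>
    using lift_Suc_mono_less[of "\<lambda>k. - t \<omega> (f k)" k l] f(2) that by simp
  then have "inj j"
    by (metis j(2) injI less_irrefl linorder_neqE_nat)
  have C_sym: "C \<omega> x y = C \<omega> y x" if "x \<in> \<Phi> \<omega>" "y \<in> \<Phi> \<omega>" "x \<noteq> y" for x y
    using edges \<omega> that unfolding cond_indep_edges_def by blast
  have "\<omega> \<in> edge_event M N X C (fst (step j k)) (snd (step j k))" for k
  proof -
    have "f k \<noteq> f (Suc k)"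
      using f(2)[of k] by auto
    then show ?thesis
      using \<omega> j f(1,3) C_sym[of "f k" "f (Suc k)"] by (auto simp: edge_event_def step_def min_def max_def)
  qed
  moreover have "step (restrict j {..n}) k = step j k" if "k < n" for k
    using that by (simp add: step_def)
  ultimately have "\<omega> \<in> chain_event n B D (restrict j {..n})"
    using \<omega> j f(4,5) \<open>inj j\<close>
    by (auto simp: chain_event_def present_def timer_seq_def inj_on_def)
  then show ?thesis
    by (intro bexI[of _ "restrict j {..n}"]) auto
qed

text \<open>An infinite descending chain has a tail in one timer level, starting in some ball of
  integer radius. There are countably many pairs of radius and level, and each is excluded almost
  surely.\<close>

lemma AE_wf:
  assumes H: "(\<integral>\<^sup>+y. ennreal (h 0 y) \<partial>lborel) < \<infinity>"
  shows "AE \<omega> in M. wf {(y, x). x \<in> \<Phi> \<omega> \<and> y \<in> \<Phi> \<omega> \<and> t \<omega> y < t \<omega> x \<and> C \<omega> x y}"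
proof -
  obtain H where H: "(\<integral>\<^sup>+y. ennreal (h 0 y) \<partial>lborel) = ennreal H" "0 \<le> H"
    using H by (cases "\<integral>\<^sup>+y. ennreal (h 0 y) \<partial>lborel") auto
  \<comment> \<open>The maximum with 0 guarantees that \<open>m\<close> is positive.\<close>
  obtain m where m: "lam * H < real m" "0 < m"
    using reals_Archimedean2[of "max (lam * H) 0"] by auto
  define D where "D a = {s. timer_level m s = a}" for a
  have D: "D a \<in> sets borel" for a
    unfolding D_def by measurable
  have "AE \<omega> in M. \<exists>n. \<forall>i\<in>{..n} \<rightarrow>\<^sub>E UNIV. \<omega> \<notin> chain_event n (ball 0 (real r)) (D a) i" for r a
  proof (rule AE_no_infinite_chain[OF _ _ D H])
    have "lam * measure (uniform_measure lborel {0..1}) (D a) * H \<le> lam * (1 / m) * H"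
      unfolding D_def using lam_nonneg H(2) m(2)
      by (intro mult_right_mono mult_left_mono measure_timer_level) auto
    also have "\<dots> < 1"
      using m by (simp add: field_simps)
    finally show "lam * measure (uniform_measure lborel {0..1}) (D a) * H < 1" .
  qed auto
  then have "AE \<omega> in M. \<forall>r a. \<exists>n. \<forall>i\<in>{..n} \<rightarrow>\<^sub>E UNIV. \<omega> \<notin> chain_event n (ball 0 (real r)) (D a) i"
    by (simp add: AE_all_countable)
  then show ?thesis
  proof (rule AE_mp, intro AE_I2 impI)
    fix \<omega> assume \<omega>: "\<omega> \<in> space M"
      and none: "\<forall>r a. \<exists>n. \<forall>i\<in>{..n} \<rightarrow>\<^sub>E UNIV. \<omega> \<notin> chain_event n (ball 0 (real r)) (D a) i"
    show "wf {(y, x). x \<in> \<Phi> \<omega> \<and> y \<in> \<Phi> \<omega> \<and> t \<omega> y < t \<omega> x \<and> C \<omega> x y}"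
    proof (rule ccontr)
      assume "\<not> wf {(y, x). x \<in> \<Phi> \<omega> \<and> y \<in> \<Phi> \<omega> \<and> t \<omega> y < t \<omega> x \<and> C \<omega> x y}"
      then obtain f a where f: "\<And>k. f k \<in> \<Phi> \<omega>" "\<And>k. t \<omega> (f (Suc k)) < t \<omega> (f k)"
        "\<And>k. C \<omega> (f k) (f (Suc k))" "\<And>k. timer_level m (t \<omega> (f k)) = a"
        by (rule descending_chain_in_timer_level) blast
      obtain r :: nat where "norm (f 0) < r"
        using reals_Archimedean2 by blast
      then have "f 0 \<in> ball 0 (real r)" by simp
      moreover have "t \<omega> (f k) \<in> D a" for k
        using f(4) by (simp add: D_def)
      ultimately have "\<exists>i\<in>{..n} \<rightarrow>\<^sub>E UNIV. \<omega> \<in> chain_event n (ball 0 (real r)) (D a) i" for n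
        by (intro chain_in_chain_event[where f = f] \<omega> f(1-3)) auto
      with none show False by blast
    qed
  qed
qed

end

theorem proposition1:
  fixes M :: "'w measure" and lam :: real
    and \<Phi> :: "'w \<Rightarrow> (real^2) set"
    and t :: "'w \<Rightarrow> real^2 \<Rightarrow> real"
    and C :: "'w \<Rightarrow> real^2 \<Rightarrow> real^2 \<Rightarrow> bool"
    and h :: "real^2 \<Rightarrow> real^2 \<Rightarrow> real"
  assumes h_measurable: "(\<lambda>(x, y). h x y) \<in> borel_measurable (borel \<Otimes>\<^sub>M borel)"
    and h_range: "\<And>x y. h x y \<in> {0..1}"
    and h_symmetric: "\<And>x y. h x y = h y x"
    and h_translation: "\<And>x y. h x y = h 0 (y - x)"
    and poisson: "homogeneous_poisson_process M lam \<Phi>"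
    and marks: "matern_marks M \<Phi> t C h"
    and h_integral: "(\<integral>\<^sup>+ x. ennreal (h 0 x) \<partial>lborel) < \<infinity>"
  shows "AE \<omega> in M. \<exists>!e. thinning_indicators (\<Phi> \<omega>) (t \<omega>) (C \<omega>) e"
proof -
  \<comment> \<open>The conclusion does not mention the enumeration, so any one witnessing the marks
    will do.\<close>
  obtain N X where "point_enumeration M \<Phi> N X" "iid_uniform_timers M N X t"
    "cond_indep_edges M \<Phi> N X t C h"
    using marks unfolding matern_marks_def by blast
  then interpret marked_poisson M lam \<Phi> N X t C h
    using assms by unfold_locales
  from AE_wf[OF h_integral] show ?thesis
    by (rule AE_mp) (intro AE_I2 impI ex1_thinning_indicators)
qed

end
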